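(* Let $J\in\{I,J_1,J_+\}$, $\otimes\in\{\times,\boxdot\}$ and let $G$ be an abelian group. For a closure space $X$ and a subspace $A\subseteq X$ there are long exact sequences $$\cdots\to H_J^n(X,A;G)\xrightarrow{j^*}H_J^n(X;G)\xrightarrow{i^*}H_J^n(A;G)\xrightarrow{\delta}H_J^{n+1}(X,A;G)\to\cdots$$ $$\cdots\to H_{(J,\otimes)}^n(X,A;G)\xrightarrow{j^*}H_{(J,\otimes)}^n(X;G)\xrightarrow{i^*}H_{(J,\otimes)}^n(A;G)\xrightarrow{\delta}H_{(J,\otimes)}^{n+1}(X,A;G)\to\cdots$$
   Context: A closure space $(X,c)$ is a set $X$ with a map $c:\mathcal P(X)\to\mathcal P(X)$ such that $c(\emptyset)=\emptyset$, $A\subseteq c(A)$, and $c(A\cup B)=c(A)\cup c(B)$. A subset $A\subseteq X$ carries the subspace closure $B\mapsto c(B)\cap A$. The interior is $i(A)=X\setminus c(X\setminus A)$, and $V$ is a neighborhood of $x$ if $x\in i(V)$. A map $f:(X,c)\to(Y,d)$ is continuous if $f(c(A))\subseteq d(f(A))$ for all $A\subseteq X$. Topological spaces are closure spaces via the topological closure. The product $X\times Y$ is the set product with the closure for which the sets $U\times V$ ($U$ a neighborhood of $x$, $V$ of $y$) form a neighborhood base at $(x,y)$; the inductive product $X\boxdot Y$ is the set product with the closure for which the sets $(\{x\}\times V)\cup(U\times\{y\})$ form a neighborhood base at $(x,y)$. Spaces: $I=[0,1]$ with the usual topology; $J_1=\{0,1\}$ with the indiscrete closure; $J_+=\{0,1\}$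 with $c(\{0\})=\{0,1\}$, $c(\{1\})=\{1\}$. Singular simplices: $|\Delta^n|^{I}$ is the standard topological $n$-simplex; $|\Delta^n|^{J_1}$ is $\{0,\dots,n\}$ with the indiscrete closure; $|\Delta^n|^{J_+}$ is $\{0,\dots,n\}$ with $c(\{i\})=\{j: j\ge i\}$. $C^J_n(X)$ is the free abelian group on continuous maps $\sigma:|\Delta^n|^J\to X$, with $\partial\sigma=\sum_{i=0}^n(-1)^i\sigma\circ d^i$, $d^i$ the $i$-th face inclusion. Singular cubes: $J^{\otimes n}$ is the $n$-fold $\otimes$-product (a point if $n=0$). Let $Q_n(X)$ be the free abelian group on continuous maps $\sigma:J^{\otimes n}\to X$ and $D_n(X)$ the subgroup generated by the degenerate $\sigma$, i.e. those that do not depend on their $i$-th coordinate for some $1\le i\le n$. Then $C^{(J,\otimes)}_n(X)=Q_n(X)/D_n(X)$, with $\partial\sigma=\sum_{i=1}^n(-1)^i(A_i\sigma-B_i\sigma)$, where $A_i\sigma$ (resp. $B_i\sigma$) is $\sigma$ with $0$ (resp. $1$) inserted in the $i$-th coordinate. Let $C^J_\bullet(X,A)=C^J_\bullet(X)/C^J_\bullet(A)$ and $C^{(J,\otimes)}_\bullet(X,A)=C^{(J,\otimes)}_\bullet(X)/C^{(J,\otimes)}_\bullet(A)$. The groups $H_J^n(X;G)$, $H_J^n(X,A;G)$, $H_{(J,\otimes)}^n(X;G)$, $H_{(J,\otimes)}^n(X,A;G)$ are the cohomology groups of the cochain complexes obtained by applying $\operatorname{Hom}_{\mathbb Z}(-,G)$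 to $C^J_\bullet(X)$, $C^J_\bullet(X,A)$, $C^{(J,\otimes)}_\bullet(X)$, $C^{(J,\otimes)}_\bullet(X,A)$. The maps $i^*,j^*$ are induced by the inclusion $C_\bullet(A)\to C_\bullet(X)$ and the quotient $C_\bullet(X)\to C_\bullet(X,A)$. *)

theory Defs
  imports "HOL-Homology.Simplices"
begin

section \<open>Closure spaces\<close>

text \<open>The operator of a closure space is only meaningful on subsets of the underlying set.\<close>

record 'a clspace =
  points :: "'a set"
  cl :: "'a set \<Rightarrow> 'a set"

definition closure_space :: "'a clspace \<Rightarrow> bool" where
  "closure_space X \<longleftrightarrow>
     cl X {} = {} \<and>
     (\<forall>A. A \<subseteq> points X \<longrightarrow> A \<subseteq> cl X A \<and> cl X A \<subseteq> points X) \<and>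
     (\<forall>A B. A \<subseteq> points X \<longrightarrow> B \<subseteq> points X \<longrightarrow> cl X (A \<union> B) = cl X A \<union> cl X B)"

definition cl_subspace :: "'a clspace \<Rightarrow> 'a set \<Rightarrow> 'a clspace" where
  "cl_subspace X A = \<lparr>points = A, cl = (\<lambda>B. cl X B \<inter> A)\<rparr>"

definition cl_interior :: "'a clspace \<Rightarrow> 'a set \<Rightarrow> 'a set" where
  "cl_interior X A = points X - cl X (points X - A)"

definition neighborhood :: "'a clspace \<Rightarrow> 'a \<Rightarrow> 'a set \<Rightarrow> bool" where
  "neighborhood X x V \<longleftrightarrow> V \<subseteq> points X \<and> x \<in> cl_interior X V"

definition cl_continuous :: "'a clspace \<Rightarrow> 'b clspace \<Rightarrow> ('a \<Rightarrow> 'b) \<Rightarrow> bool" where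
  "cl_continuous X Y f \<longleftrightarrow>
     f \<in> points X \<rightarrow> points Y \<and> (\<forall>A. A \<subseteq> points X \<longrightarrow> f ` cl X A \<subseteq> cl Y (f ` A))"

definition topological_clspace :: "'a topology \<Rightarrow> 'a clspace" where
  "topological_clspace T = \<lparr>points = topspace T, cl = Abstract_Topology.closure_of T\<rparr>"

definition indiscrete_clspace :: "'a set \<Rightarrow> 'a clspace" where
  "indiscrete_clspace S = \<lparr>points = S, cl = (\<lambda>B. if B = {} then {} else S)\<rparr>"

text \<open>The closure with \<open>c({i}) = {j \<in> S. j \<ge> i}\<close>; on a finite set, additivity
  determines it from its values on singletons.\<close>

definition upward_clspace :: "'a::order set \<Rightarrow> 'a clspace" where
  "upward_clspace S = \<lparr>points = S, cl = (\<lambda>B. {j \<in> S. \<exists>i\<in>B. i \<le> j})\<rparr>"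

text \<open>Transport of structure along a map that is injective on the points.\<close>

definition relabel :: "('a \<Rightarrow> 'b) \<Rightarrow> 'a clspace \<Rightarrow> 'b clspace" where
  "relabel h X = \<lparr>points = h ` points X, cl = (\<lambda>B. h ` cl X {x \<in> points X. h x \<in> B})\<rparr>"

text \<open>A closure is determined by neighborhood bases: \<open>p\<close> lies in the closure
  of \<open>S\<close> iff every member of the base at \<open>p\<close> meets \<open>S\<close>.  The lemmas
  \<open>neighborhood_cl_product\<close> and \<open>neighborhood_cl_inductive_product\<close> below confirm that the
  prescribed sets are indeed neighborhood bases.\<close>

definition clspace_of_bases :: "'a set \<Rightarrow> ('a \<Rightarrow> 'a set set) \<Rightarrow> 'a clspace" where
  "clspace_of_bases P \<B> = \<lparr>points = P, cl = (\<lambda>S. {p \<in> P. \<forall>N \<in> \<B> p. N \<inter> S \<noteq> {}})\<rparr>"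

definition cl_product :: "'a clspace \<Rightarrow> 'b clspace \<Rightarrow> ('a \<times> 'b) clspace" where
  "cl_product X Y = clspace_of_bases (points X \<times> points Y)
     (\<lambda>(x, y). {U \<times> V | U V. neighborhood X x U \<and> neighborhood Y y V})"

definition cl_inductive_product :: "'a clspace \<Rightarrow> 'b clspace \<Rightarrow> ('a \<times> 'b) clspace" where
  "cl_inductive_product X Y = clspace_of_bases (points X \<times> points Y)
     (\<lambda>(x, y). {({x} \<times> V) \<union> (U \<times> {y}) | U V. neighborhood X x U \<and> neighborhood Y y V})"

lemma closure_space_mono:
  assumes "closure_space X" "A \<subseteq> B" "B \<subseteq> points X"
  shows "cl X A \<subseteq> cl X B"
proof -
  have "cl X (A \<union> B) = cl X A \<union> cl X B"
    using assms unfolding closure_space_def by (metis order_trans)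
  then show ?thesis
    using assms(2) by (metis Un_absorb1 Un_upper1)
qed

lemma neighborhood_points: "closure_space X \<Longrightarrow> x \<in> points X \<Longrightarrow> neighborhood X x (points X)"
  by (auto simp: neighborhood_def cl_interior_def closure_space_def)

lemma neighborhood_mem: "closure_space X \<Longrightarrow> neighborhood X x U \<Longrightarrow> x \<in> U"
  unfolding neighborhood_def cl_interior_def closure_space_def by blast

lemma neighborhood_Int:
  assumes X: "closure_space X" and U: "neighborhood X x U" and V: "neighborhood X x V"
  shows "neighborhood X x (U \<inter> V)"
proof -
  have "cl X ((points X - U) \<union> (points X - V)) = cl X (points X - U) \<union> cl X (points X - V)"
    using X by (simp add: closure_space_def)
  moreover have "points X - U \<inter> V = (points X - U) \<union> (points X - V)"
    by blast
  ultimately show ?thesis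
    using U V unfolding neighborhood_def cl_interior_def by auto
qed

lemma closure_space_clspace_of_bases:
  assumes ne: "\<And>p. p \<in> P \<Longrightarrow> \<B> p \<noteq> {}"
    and mem: "\<And>p N. p \<in> P \<Longrightarrow> N \<in> \<B> p \<Longrightarrow> p \<in> N"
    and int: "\<And>p M N. p \<in> P \<Longrightarrow> M \<in> \<B> p \<Longrightarrow> N \<in> \<B> p \<Longrightarrow> \<exists>L \<in> \<B> p. L \<subseteq> M \<inter> N"
  shows "closure_space (clspace_of_bases P \<B>)"
proof -
  define c where "c = (\<lambda>S. {p \<in> P. \<forall>N \<in> \<B> p. N \<inter> S \<noteq> {}})"
  have "c {} = {}"
    using ne unfolding c_def by blast
  moreover have "A \<subseteq> c A \<and> c A \<subseteq> P" if "A \<subseteq> P" for A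
    using that mem unfolding c_def by blast
  moreover have "c (A \<union> B) = c A \<union> c B" for A B
  proof
    show "c (A \<union> B) \<subseteq> c A \<union> c B"
    proof
      fix p assume p: "p \<in> c (A \<union> B)"
      show "p \<in> c A \<union> c B"
      proof (rule ccontr)
        assume "p \<notin> c A \<union> c B"
        with p obtain M N where *: "p \<in> P" "M \<in> \<B> p" "N \<in> \<B> p" "M \<inter> A = {}" "N \<inter> B = {}"
          unfolding c_def by blast
        then obtain L where "L \<in> \<B> p" "L \<subseteq> M \<inter> N"
          using int by meson
        with * have "L \<in> \<B> p" "L \<inter> (A \<union> B) = {}" by blast+
        with p show False unfolding c_def by blast
      qed
    qed
    show "c A \<union> c B \<subseteq> c (A \<union> B)"
      unfolding c_def by blast
  qed
  moreover have "points (clspace_of_bases P \<B>) = P" "cl (clspace_of_bases P \<B>) = c"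
    by (simp_all add: clspace_of_bases_def c_def)
  ultimately show ?thesis
    by (simp only: closure_space_def) blast
qed

lemma neighborhood_clspace_of_bases:
  assumes "\<And>N. N \<in> \<B> p \<Longrightarrow> N \<subseteq> P" "p \<in> P"
  shows "neighborhood (clspace_of_bases P \<B>) p W \<longleftrightarrow> W \<subseteq> P \<and> (\<exists>N \<in> \<B> p. N \<subseteq> W)"
proof -
  have "P - {q \<in> P. \<forall>N \<in> \<B> q. N \<inter> (P - W) \<noteq> {}} = {q \<in> P. \<exists>N \<in> \<B> q. N \<inter> (P - W) = {}}"
    by blast
  moreover have "N \<inter> (P - W) = {} \<longleftrightarrow> N \<subseteq> W" if "N \<in> \<B> p" for N
    using assms(1)[OF that] by blast
  ultimately show ?thesis
    unfolding neighborhood_def cl_interior_def clspace_of_bases_def using assms(2) by auto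
qed

lemma closure_space_cl_product:
  assumes X: "closure_space X" and Y: "closure_space Y"
  shows "closure_space (cl_product X Y)"
  unfolding cl_product_def
proof (rule closure_space_clspace_of_bases)
  let ?B = "\<lambda>(x, y). {U \<times> V | U V. neighborhood X x U \<and> neighborhood Y y V}"
  fix p assume p: "p \<in> points X \<times> points Y"
  obtain x y where xy: "p = (x, y)" by (cases p)
  have B: "N \<in> ?B p \<longleftrightarrow> (\<exists>U V. N = U \<times> V \<and> neighborhood X x U \<and> neighborhood Y y V)" for N
    by (simp add: xy)
  have "neighborhood X x (points X)" "neighborhood Y y (points Y)"
    using p X Y by (simp_all add: xy neighborhood_points)
  then show "?B p \<noteq> {}"
    by (metis B empty_iff)
  show "p \<in> N" if N: "N \<in> ?B p" for N
  proof -
    obtain U V where "N = U \<times> V" "neighborhood X x U" "neighborhood Y y V"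
      using N unfolding B by (elim exE conjE) (rule that)
    then show ?thesis
      using neighborhood_mem[OF X] neighborhood_mem[OF Y] by (simp add: xy)
  qed
  show "\<exists>L \<in> ?B p. L \<subseteq> M \<inter> N" if MN: "M \<in> ?B p" "N \<in> ?B p" for M N
  proof -
    obtain U V where M: "M = U \<times> V" "neighborhood X x U" "neighborhood Y y V"
      using MN(1) unfolding B by (elim exE conjE) (rule that)
    obtain U' V' where N: "N = U' \<times> V'" "neighborhood X x U'" "neighborhood Y y V'"
      using MN(2) unfolding B by (elim exE conjE) (rule that)
    let ?L = "(U \<inter> U') \<times> (V \<inter> V')"
    have "?L \<in> ?B p"
      unfolding B
      by (intro exI conjI) (rule refl neighborhood_Int[OF X M(2) N(2)] neighborhood_Int[OF Y M(3) N(3)])+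
    moreover have "?L \<subseteq> M \<inter> N"
      unfolding M(1) N(1) by blast
    ultimately show ?thesis ..
  qed
qed

lemma closure_space_cl_inductive_product:
  assumes X: "closure_space X" and Y: "closure_space Y"
  shows "closure_space (cl_inductive_product X Y)"
  unfolding cl_inductive_product_def
proof (rule closure_space_clspace_of_bases)
  let ?B = "\<lambda>(x, y). {{x} \<times> V \<union> U \<times> {y} | U V. neighborhood X x U \<and> neighborhood Y y V}"
  fix p assume p: "p \<in> points X \<times> points Y"
  obtain x y where xy: "p = (x, y)" by (cases p)
  have B: "N \<in> ?B p \<longleftrightarrow> (\<exists>U V. N = {x} \<times> V \<union> U \<times> {y} \<and> neighborhood X x U \<and> neighborhood Y y V)" for N
    by (simp add: xy)
  have "neighborhood X x (points X)" "neighborhood Y y (points Y)"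
    using p X Y by (simp_all add: xy neighborhood_points)
  then show "?B p \<noteq> {}"
    by (metis B empty_iff)
  show "p \<in> N" if N: "N \<in> ?B p" for N
  proof -
    obtain U V where "N = {x} \<times> V \<union> U \<times> {y}" "neighborhood X x U" "neighborhood Y y V"
      using N unfolding B by (elim exE conjE) (rule that)
    then show ?thesis
      using neighborhood_mem[OF X] neighborhood_mem[OF Y] by (simp add: xy)
  qed
  show "\<exists>L \<in> ?B p. L \<subseteq> M \<inter> N" if MN: "M \<in> ?B p" "N \<in> ?B p" for M N
  proof -
    obtain U V where M: "M = {x} \<times> V \<union> U \<times> {y}" "neighborhood X x U" "neighborhood Y y V"
      using MN(1) unfolding B by (elim exE conjE) (rule that)
    obtain U' V' where N: "N = {x} \<times> V' \<union> U' \<times> {y}" "neighborhood X x U'" "neighborhood Y y V'"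
      using MN(2) unfolding B by (elim exE conjE) (rule that)
    let ?L = "{x} \<times> (V \<inter> V') \<union> (U \<inter> U') \<times> {y}"
    have "?L \<in> ?B p"
      unfolding B
      by (intro exI conjI) (rule refl neighborhood_Int[OF X M(2) N(2)] neighborhood_Int[OF Y M(3) N(3)])+
    moreover have "?L \<subseteq> M \<inter> N"
      unfolding M(1) N(1) by blast
    ultimately show ?thesis ..
  qed
qed

lemma neighborhood_cl_product:
  assumes "x \<in> points X" "y \<in> points Y"
  shows "neighborhood (cl_product X Y) (x, y) W \<longleftrightarrow> W \<subseteq> points X \<times> points Y \<and>
    (\<exists>U V. neighborhood X x U \<and> neighborhood Y y V \<and> U \<times> V \<subseteq> W)"
proof -
  let ?B = "\<lambda>(x, y). {U \<times> V | U V. neighborhood X x U \<and> neighborhood Y y V}"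
  have "N \<subseteq> points X \<times> points Y" if "N \<in> ?B (x, y)" for N
    using that assms by (auto simp: neighborhood_def)
  moreover have "(x, y) \<in> points X \<times> points Y"
    using assms by simp
  ultimately have "neighborhood (cl_product X Y) (x, y) W \<longleftrightarrow>
      W \<subseteq> points X \<times> points Y \<and> (\<exists>N \<in> ?B (x, y). N \<subseteq> W)"
    unfolding cl_product_def by (rule neighborhood_clspace_of_bases)
  moreover have "(\<exists>N \<in> {f U V | U V. P U V}. N \<subseteq> W) \<longleftrightarrow> (\<exists>U V. P U V \<and> f U V \<subseteq> W)"
    for f :: "'a set \<Rightarrow> 'b set \<Rightarrow> ('a \<times> 'b) set" and P
    by blast
  ultimately show ?thesis
    by (simp only: prod.case conj_assoc)
qed

lemma neighborhood_cl_inductive_product: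
  assumes "x \<in> points X" "y \<in> points Y"
  shows "neighborhood (cl_inductive_product X Y) (x, y) W \<longleftrightarrow> W \<subseteq> points X \<times> points Y \<and>
    (\<exists>U V. neighborhood X x U \<and> neighborhood Y y V \<and> {x} \<times> V \<union> U \<times> {y} \<subseteq> W)"
proof -
  let ?B = "\<lambda>(x, y). {{x} \<times> V \<union> U \<times> {y} | U V. neighborhood X x U \<and> neighborhood Y y V}"
  have "N \<subseteq> points X \<times> points Y" if "N \<in> ?B (x, y)" for N
    using that assms by (auto simp: neighborhood_def)
  moreover have "(x, y) \<in> points X \<times> points Y"
    using assms by simp
  ultimately have "neighborhood (cl_inductive_product X Y) (x, y) W \<longleftrightarrow>
      W \<subseteq> points X \<times> points Y \<and> (\<exists>N \<in> ?B (x, y). N \<subseteq> W)"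
    unfolding cl_inductive_product_def by (rule neighborhood_clspace_of_bases)
  moreover have "(\<exists>N \<in> {f U V | U V. P U V}. N \<subseteq> W) \<longleftrightarrow> (\<exists>U V. P U V \<and> f U V \<subseteq> W)"
    for f :: "'a set \<Rightarrow> 'b set \<Rightarrow> ('a \<times> 'b) set" and P
    by blast
  ultimately show ?thesis
    by (simp only: prod.case conj_assoc)
qed

section \<open>Intervals, cubes and simplices\<close>

datatype interval = Interval_I | Interval_J1 | Interval_Jplus

text \<open>To treat the three intervals uniformly, the two-point set \<open>{0, 1}\<close> is taken inside the reals.\<close>

fun interval_space :: "interval \<Rightarrow> real clspace" where
  "interval_space Interval_I = topological_clspace (top_of_set {0..1})"
| "interval_space Interval_J1 = indiscrete_clspace {0, 1}"
| "interval_space Interval_Jplus = upward_clspace {0, 1}"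

datatype tensor = Product | Inductive_product

fun tensor_space :: "tensor \<Rightarrow> 'a clspace \<Rightarrow> 'b clspace \<Rightarrow> ('a \<times> 'b) clspace" where
  "tensor_space Product X Y = cl_product X Y"
| "tensor_space Inductive_product X Y = cl_inductive_product X Y"

text \<open>Points of the n-fold product are lists of length n.\<close>

primrec tensor_power :: "tensor \<Rightarrow> 'a clspace \<Rightarrow> nat \<Rightarrow> 'a list clspace" where
  "tensor_power T Y 0 = indiscrete_clspace {[]}"
| "tensor_power T Y (Suc n) = relabel (\<lambda>(x, xs). x # xs) (tensor_space T Y (tensor_power T Y n))"

abbreviation cube :: "interval \<Rightarrow> tensor \<Rightarrow> nat \<Rightarrow> real list clspace" where
  "cube J T n \<equiv> tensor_power T (interval_space J) n"

definition simplex_vertex :: "nat \<Rightarrow> nat \<Rightarrow> real" where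
  "simplex_vertex i = (\<lambda>j. if j = i then 1 else 0)"

text \<open>For uniformity, a point \<open>i\<close> of the finite simplex \<open>{0..n}\<close> is represented by the
  \<open>i\<close>-th vertex of the standard simplex.  All face inclusions are then restrictions of
  \<^const>\<open>simplical_face\<close>, see \<open>simplical_face_simplex_vertex\<close>.\<close>

fun simplex :: "interval \<Rightarrow> nat \<Rightarrow> (nat \<Rightarrow> real) clspace" where
  "simplex Interval_I n =
     topological_clspace (subtopology (powertop_real UNIV) (standard_simplex n))"
| "simplex Interval_J1 n = relabel simplex_vertex (indiscrete_clspace {0..n})"
| "simplex Interval_Jplus n = relabel simplex_vertex (upward_clspace {0..n})"

lemma inj_simplex_vertex: "inj simplex_vertex"
  by (auto simp: inj_on_def simplex_vertex_def fun_eq_iff split: if_splits)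

lemma simplical_face_simplex_vertex:
  "simplical_face i (simplex_vertex k) = simplex_vertex (if k < i then k else k + 1)"
  by (auto simp: simplical_face_def simplex_vertex_def fun_eq_iff)

section \<open>Chain complexes and their cohomology\<close>

text \<open>Complexes are indexed by all integers (with zero groups in negative degrees);
  \<open>bd C n\<close> maps degree \<open>n\<close> to degree \<open>n - 1\<close>.\<close>

record 'c chain_complex =
  grp :: "int \<Rightarrow> 'c monoid"
  bd :: "int \<Rightarrow> 'c \<Rightarrow> 'c"

definition quotient_complex :: "'c chain_complex \<Rightarrow> (int \<Rightarrow> 'c set) \<Rightarrow> 'c set chain_complex" where
  "quotient_complex C N =
     \<lparr>grp = (\<lambda>n. grp C n Mod N n),
      bd = (\<lambda>n S. N (n - 1) <#>\<^bsub>grp C (n - 1)\<^esub> (bd C n ` S))\<rparr>"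

definition quotient_map :: "'c chain_complex \<Rightarrow> (int \<Rightarrow> 'c set) \<Rightarrow> int \<Rightarrow> 'c \<Rightarrow> 'c set" where
  "quotient_map C N n x = N n #>\<^bsub>grp C n\<^esub> x"

definition hom_group :: "('c, 'k) monoid_scheme \<Rightarrow> ('g, 'm) monoid_scheme \<Rightarrow> ('c \<Rightarrow> 'g) monoid" where
  "hom_group H G =
     \<lparr>carrier = hom H G \<inter> extensional (carrier H),
      monoid.mult = (\<lambda>\<phi> \<psi>. restrict (\<lambda>x. \<phi> x \<otimes>\<^bsub>G\<^esub> \<psi> x) (carrier H)),
      one = restrict (\<lambda>x. \<one>\<^bsub>G\<^esub>) (carrier H)\<rparr>"

definition cochains :: "'c chain_complex \<Rightarrow> ('g, 'm) monoid_scheme \<Rightarrow> int \<Rightarrow> ('c \<Rightarrow> 'g) monoid" where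
  "cochains C G n = hom_group (grp C n) G"

definition pullback :: "'c chain_complex \<Rightarrow> (int \<Rightarrow> 'c \<Rightarrow> 'd) \<Rightarrow> int \<Rightarrow> ('d \<Rightarrow> 'g) \<Rightarrow> 'c \<Rightarrow> 'g" where
  "pullback C f n \<phi> = restrict (\<phi> \<circ> f n) (carrier (grp C n))"

definition coboundary :: "'c chain_complex \<Rightarrow> int \<Rightarrow> ('c \<Rightarrow> 'g) \<Rightarrow> 'c \<Rightarrow> 'g" where
  "coboundary C n \<phi> = pullback C (bd C) (n + 1) \<phi>"

definition cocycles :: "'c chain_complex \<Rightarrow> ('g, 'm) monoid_scheme \<Rightarrow> int \<Rightarrow> ('c \<Rightarrow> 'g) set" where
  "cocycles C G n = kernel (cochains C G n) (cochains C G (n + 1)) (coboundary C n)"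

definition coboundaries :: "'c chain_complex \<Rightarrow> ('g, 'm) monoid_scheme \<Rightarrow> int \<Rightarrow> ('c \<Rightarrow> 'g) set" where
  "coboundaries C G n = coboundary C (n - 1) ` carrier (cochains C G (n - 1))"

definition cohomology ::
  "'c chain_complex \<Rightarrow> ('g, 'm) monoid_scheme \<Rightarrow> int \<Rightarrow> ('c \<Rightarrow> 'g) set monoid" where
  "cohomology C G n = (cochains C G n)\<lparr>carrier := cocycles C G n\<rparr> Mod coboundaries C G n"

text \<open>The map on the cohomology of \<open>D\<close> induced by a chain map \<open>f\<close> from \<open>C\<close> to \<open>D\<close>.\<close>

definition cohomology_map ::
  "'c chain_complex \<Rightarrow> (int \<Rightarrow> 'c \<Rightarrow> 'd) \<Rightarrow> ('g, 'm) monoid_scheme \<Rightarrow> int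
     \<Rightarrow> ('d \<Rightarrow> 'g) set \<Rightarrow> ('c \<Rightarrow> 'g) set" where
  "cohomology_map C f G n \<Phi> = coboundaries C G n <#>\<^bsub>cochains C G n\<^esub> (pullback C f n ` \<Phi>)"

text \<open>The connecting map of \<open>B \<rightarrow> C \<rightarrow> Q\<close> with maps \<open>i\<close> and \<open>q\<close>: extend a cocycle in the given class
  on \<open>B\<close> to a cochain \<open>\<phi>\<close> on \<open>C\<close>, and write the coboundary of \<open>\<phi>\<close> as the pullback of a
  cochain \<open>\<psi>\<close> on \<open>Q\<close>.  The \<open>\<psi>\<close> that arise from all choices make up exactly one
  cohomology class, so that no choice of representatives is needed.\<close>

definition connecting_map ::
  "'b chain_complex \<Rightarrow> (int \<Rightarrow> 'b \<Rightarrow> 'c) \<Rightarrow> 'c chain_complex \<Rightarrow> (int \<Rightarrow> 'c \<Rightarrow> 'd) \<Rightarrow> 'd chain_complex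
     \<Rightarrow> ('g, 'm) monoid_scheme \<Rightarrow> int \<Rightarrow> ('b \<Rightarrow> 'g) set \<Rightarrow> ('d \<Rightarrow> 'g) set" where
  "connecting_map B i C q Q G n \<Phi> =
     {\<psi> \<in> carrier (cochains Q G (n + 1)).
        \<exists>\<phi> \<in> carrier (cochains C G n).
          pullback B i n \<phi> \<in> \<Phi> \<and> pullback C q (n + 1) \<psi> = coboundary C n \<phi>}"

definition exact_at ::
  "('a, 'm) monoid_scheme \<Rightarrow> ('a \<Rightarrow> 'b) \<Rightarrow> ('b, 'n) monoid_scheme \<Rightarrow> ('b \<Rightarrow> 'c) \<Rightarrow> ('c, 'k) monoid_scheme \<Rightarrow> bool" where
  "exact_at H f K g L \<longleftrightarrow> group_hom H K f \<and> group_hom K L g \<and> kernel K L g = f ` carrier H"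

definition long_exact_sequence ::
  "(int \<Rightarrow> 'a monoid) \<Rightarrow> (int \<Rightarrow> 'a \<Rightarrow> 'b) \<Rightarrow> (int \<Rightarrow> 'b monoid) \<Rightarrow> (int \<Rightarrow> 'b \<Rightarrow> 'c)
     \<Rightarrow> (int \<Rightarrow> 'c monoid) \<Rightarrow> (int \<Rightarrow> 'c \<Rightarrow> 'a) \<Rightarrow> bool" where
  "long_exact_sequence H f K g L d \<longleftrightarrow>
     (\<forall>n. exact_at (H n) (f n) (K n) (g n) (L n) \<and>
          exact_at (K n) (g n) (L n) (d n) (H (n + 1)) \<and>
          exact_at (L n) (d n) (H (n + 1)) (f (n + 1)) (K (n + 1)))"

section \<open>Singular chains\<close>

text \<open>As usual in the library, maps out of a space are made extensional, so that a singular simplex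
  (cube) is determined by its values on the simplex (cube).\<close>

definition singular_simplices :: "interval \<Rightarrow> 'a clspace \<Rightarrow> int \<Rightarrow> ((nat \<Rightarrow> real) \<Rightarrow> 'a) set" where
  "singular_simplices J X n =
     (if n < 0 then {}
      else {\<sigma> \<in> extensional (points (simplex J (nat n))). cl_continuous (simplex J (nat n)) X \<sigma>})"

definition cl_simplex_face :: "interval \<Rightarrow> nat \<Rightarrow> nat \<Rightarrow> ((nat \<Rightarrow> real) \<Rightarrow> 'a) \<Rightarrow> (nat \<Rightarrow> real) \<Rightarrow> 'a" where
  "cl_simplex_face J n i \<sigma> = restrict (\<sigma> \<circ> simplical_face i) (points (simplex J (n - 1)))"

definition simplex_boundary :: "interval \<Rightarrow> nat \<Rightarrow> 'a chain \<Rightarrow> 'a chain" where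
  "simplex_boundary J n =
     (if n = 0 then (\<lambda>_. 0)
      else frag_extend (\<lambda>\<sigma>. \<Sum>i=0..n. frag_cmul ((-1) ^ i) (frag_of (cl_simplex_face J n i \<sigma>))))"

definition simplicial_chains :: "interval \<Rightarrow> 'a clspace \<Rightarrow> 'a chain chain_complex" where
  "simplicial_chains J X =
     \<lparr>grp = (\<lambda>n. free_Abelian_group (singular_simplices J X n)),
      bd = (\<lambda>n. simplex_boundary J (nat n))\<rparr>"

definition singular_cubes :: "interval \<Rightarrow> tensor \<Rightarrow> 'a clspace \<Rightarrow> int \<Rightarrow> (real list \<Rightarrow> 'a) set" where
  "singular_cubes J T X n =
     (if n < 0 then {}
      else {\<sigma> \<in> extensional (points (cube J T (nat n))). cl_continuous (cube J T (nat n)) X \<sigma>})"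

definition degenerate_cubes :: "interval \<Rightarrow> tensor \<Rightarrow> 'a clspace \<Rightarrow> int \<Rightarrow> (real list \<Rightarrow> 'a) set" where
  "degenerate_cubes J T X n =
     {\<sigma> \<in> singular_cubes J T X n.
        \<exists>i \<in> {1..nat n}. \<forall>x \<in> points (cube J T (nat n)). \<forall>y \<in> points (cube J T (nat n)).
          (\<forall>k \<in> {1..nat n}. k \<noteq> i \<longrightarrow> x ! (k - 1) = y ! (k - 1)) \<longrightarrow> \<sigma> x = \<sigma> y}"

text \<open>Coordinates are counted from 1, list positions from 0.\<close>

definition insert_coordinate :: "nat \<Rightarrow> 'a \<Rightarrow> 'a list \<Rightarrow> 'a list" where
  "insert_coordinate i e xs = take (i - 1) xs @ e # drop (i - 1) xs"

definition cl_cube_face ::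
  "interval \<Rightarrow> tensor \<Rightarrow> nat \<Rightarrow> nat \<Rightarrow> real \<Rightarrow> (real list \<Rightarrow> 'a) \<Rightarrow> real list \<Rightarrow> 'a" where
  "cl_cube_face J T n i e \<sigma> = restrict (\<sigma> \<circ> insert_coordinate i e) (points (cube J T (n - 1)))"

definition cube_boundary ::
  "interval \<Rightarrow> tensor \<Rightarrow> nat \<Rightarrow> ((real list \<Rightarrow> 'a) \<Rightarrow>\<^sub>0 int) \<Rightarrow> ((real list \<Rightarrow> 'a) \<Rightarrow>\<^sub>0 int)" where
  "cube_boundary J T n =
     frag_extend (\<lambda>\<sigma>. \<Sum>i=1..n. frag_cmul ((-1) ^ i)
       (frag_of (cl_cube_face J T n i 0 \<sigma>) - frag_of (cl_cube_face J T n i 1 \<sigma>)))"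

definition all_cubical_chains ::
  "interval \<Rightarrow> tensor \<Rightarrow> 'a clspace \<Rightarrow> ((real list \<Rightarrow> 'a) \<Rightarrow>\<^sub>0 int) chain_complex" where
  "all_cubical_chains J T X =
     \<lparr>grp = (\<lambda>n. free_Abelian_group (singular_cubes J T X n)),
      bd = (\<lambda>n. cube_boundary J T (nat n))\<rparr>"

definition degenerate_chains ::
  "interval \<Rightarrow> tensor \<Rightarrow> 'a clspace \<Rightarrow> int \<Rightarrow> ((real list \<Rightarrow> 'a) \<Rightarrow>\<^sub>0 int) set" where
  "degenerate_chains J T X n =
     generate (free_Abelian_group (singular_cubes J T X n)) (frag_of ` degenerate_cubes J T X n)"

definition cubical_chains ::
  "interval \<Rightarrow> tensor \<Rightarrow> 'a clspace \<Rightarrow> ((real list \<Rightarrow> 'a) \<Rightarrow>\<^sub>0 int) set chain_complex" where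
  "cubical_chains J T X = quotient_complex (all_cubical_chains J T X) (degenerate_chains J T X)"

section \<open>Pairs\<close>

text \<open>A simplex or cube of a subspace is, as a function, also one of the whole space.
  On normalized cubical chains the inclusion sends a coset of \<open>D(A)\<close> to the coset of \<open>D(X)\<close>
  containing it.\<close>

definition simplicial_inclusion :: "int \<Rightarrow> 'a chain \<Rightarrow> 'a chain" where
  "simplicial_inclusion n c = c"

definition cubical_inclusion ::
  "interval \<Rightarrow> tensor \<Rightarrow> 'a clspace \<Rightarrow> int
     \<Rightarrow> ((real list \<Rightarrow> 'a) \<Rightarrow>\<^sub>0 int) set \<Rightarrow> ((real list \<Rightarrow> 'a) \<Rightarrow>\<^sub>0 int) set" where
  "cubical_inclusion J T X n S =
     degenerate_chains J T X n <#>\<^bsub>grp (all_cubical_chains J T X) n\<^esub> S"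

text \<open>The statement that a chain map \<open>i\<close> from \<open>B\<close> to \<open>C\<close> gives a long exact sequence
  relating the cohomology of \<open>C/B\<close>, \<open>C\<close> and \<open>B\<close>, with \<open>B\<close> identified with its image in \<open>C\<close>.\<close>

definition cohomology_sequence_exact ::
  "'b chain_complex \<Rightarrow> (int \<Rightarrow> 'b \<Rightarrow> 'c) \<Rightarrow> 'c chain_complex \<Rightarrow> ('g, 'm) monoid_scheme \<Rightarrow> bool" where
  "cohomology_sequence_exact B i C G \<longleftrightarrow>
     (let N = (\<lambda>n. i n ` carrier (grp B n));
          Q = quotient_complex C N;
          q = quotient_map C N
      in long_exact_sequence
           (cohomology Q G) (cohomology_map C q G)
           (cohomology C G) (cohomology_map B i G)
           (cohomology B G) (connecting_map B i C q Q G))"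

end

theory Submission
  imports Defs
begin

text \<open>
  Simplices (cubes) of \<open>A\<close> are among those of \<open>X\<close>, so sending all the other simplices (cubes) of
  \<open>X\<close> to zero retracts the chains of \<open>X\<close> onto the chains of \<open>A\<close> in each degree.  A cube of \<open>A\<close> is
  degenerate in \<open>A\<close> iff it is in \<open>X\<close>, hence the retraction passes to normalized cubical chains.
  Therefore \<open>Hom(-, G)\<close> turns the inclusion and the quotient map into a short exact sequence of
  cochain complexes, and the zigzag construction gives the long exact sequence.
\<close>

section \<open>The long exact sequence of a short exact sequence of cochain complexes\<close>

text \<open>\<open>Hom(-, G)\<close> is only left exact. The one property that is not automatic is
  that every cochain on \<open>A\<close> extends to \<open>X\<close>, and the retraction is used for
  nothing else. It therefore needs to be a homomorphism in each single degree only. In general it is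
  no chain map, because a simplex or cube outside \<open>A\<close> may have faces in
  \<open>A\<close>; a retraction by chain maps would force the connecting map to be trivial. The
  same retraction makes the inclusion of normalized cubical chains injective, which is not evident
  for maps between quotients. The connecting map is given as the set of all outcomes of the zigzag,
  so the zigzag has to show more than independence of choices: the outcomes must fill a whole coset.
  What remains is that the chains form complexes at all. This needs continuous face inclusions for
  each interval and each product, the simplicial and cubical identities, and the fact that the
  boundary of a degenerate cube is degenerate.\<close>

lemma Mod_eq_iff:
  assumes "comm_group K" "subgroup B K" "x \<in> carrier K" "y \<in> carrier K"
  shows "B #>\<^bsub>K\<^esub> x = B #>\<^bsub>K\<^esub> y \<longleftrightarrow> (\<exists>b\<in>B. y = b \<otimes>\<^bsub>K\<^esub> x)"
proof -
  interpret comm_group K by fact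
  show ?thesis
    using repr_independence[OF _ assms(3,2), of y] rcos_self[OF assms(4,2)]
    by (auto simp: r_coset_def)
qed

lemma Mod_eq_one_iff:
  assumes "comm_group K" "subgroup B K" "x \<in> carrier K"
  shows "B #>\<^bsub>K\<^esub> x = B \<longleftrightarrow> x \<in> B"
proof -
  interpret comm_group K by fact
  show ?thesis
    using coset_join1[OF _ assms(3,2)] coset_join2[OF assms(3,2)] by blast
qed

lemma Mod_mult:
  assumes "comm_group K" "subgroup B K" "x \<in> carrier K" "y \<in> carrier K"
  shows "(B #>\<^bsub>K\<^esub> x) <#>\<^bsub>K\<^esub> (B #>\<^bsub>K\<^esub> y) = B #>\<^bsub>K\<^esub> (x \<otimes>\<^bsub>K\<^esub> y)"
proof -
  interpret comm_group K by fact
  show ?thesis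
    by (rule normal.rcos_sum[OF subgroup_imp_normal]) fact+
qed

lemma Mod_comm_group:
  assumes "comm_group K" "subgroup B K"
  shows "comm_group (K Mod B)"
  by (rule comm_group.abelian_FactGroup) fact+

text \<open>\<open>f\<close> sends the coset of \<open>x\<close> into the coset of
  \<open>f x\<close> but need not fill it; multiplying by \<open>B'\<close> supplies the missing
  elements. Formulas of this shape define \<open>cohomology_map\<close>, the boundary of
  \<open>quotient_complex\<close> and \<open>cubical_inclusion\<close>.\<close>

lemma Mod_map_coset:
  assumes K: "comm_group K" and B: "subgroup B K"
    and K': "comm_group K'" and B': "subgroup B' K'"
    and f: "f \<in> hom K K'" and fB: "f ` B \<subseteq> B'" and x: "x \<in> carrier K"
  shows "B' <#>\<^bsub>K'\<^esub> f ` (B #>\<^bsub>K\<^esub> x) = B' #>\<^bsub>K'\<^esub> f x"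
proof -
  interpret K: comm_group K by fact
  interpret K': comm_group K' by fact
  interpret B: subgroup B K by fact
  interpret B': subgroup B' K' by fact
  have fx: "f x \<in> carrier K'" using f x by (auto simp: hom_def)
  have img: "f ` (B #>\<^bsub>K\<^esub> x) = (\<lambda>b. f b \<otimes>\<^bsub>K'\<^esub> f x) ` B"
  proof -
    have "B #>\<^bsub>K\<^esub> x = (\<lambda>b. b \<otimes>\<^bsub>K\<^esub> x) ` B" by (auto simp: r_coset_def)
    then show ?thesis
      using f x B.subset by (auto simp: image_image hom_def intro!: image_cong)
  qed
  have one: "f \<one>\<^bsub>K\<^esub> = \<one>\<^bsub>K'\<^esub>"
    using hom_one[OF f] K.is_group K'.is_group by blast
  show ?thesis unfolding img
  proof
    show "B' <#>\<^bsub>K'\<^esub> (\<lambda>b. f b \<otimes>\<^bsub>K'\<^esub> f x) ` B \<subseteq> B' #>\<^bsub>K'\<^esub> f x"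
    proof
      fix z assume "z \<in> B' <#>\<^bsub>K'\<^esub> (\<lambda>b. f b \<otimes>\<^bsub>K'\<^esub> f x) ` B"
      then obtain b' b where b: "b' \<in> B'" "b \<in> B" "z = b' \<otimes>\<^bsub>K'\<^esub> (f b \<otimes>\<^bsub>K'\<^esub> f x)"
        by (auto simp: set_mult_def)
      then have "f b \<in> B'" using fB by blast
      then have "z = (b' \<otimes>\<^bsub>K'\<^esub> f b) \<otimes>\<^bsub>K'\<^esub> f x" "b' \<otimes>\<^bsub>K'\<^esub> f b \<in> B'"
        using b fx by (auto simp: K'.m_assoc)
      then show "z \<in> B' #>\<^bsub>K'\<^esub> f x" by (auto simp: r_coset_def)
    qed
    show "B' #>\<^bsub>K'\<^esub> f x \<subseteq> B' <#>\<^bsub>K'\<^esub> (\<lambda>b. f b \<otimes>\<^bsub>K'\<^esub> f x) ` B"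
    proof
      fix z assume "z \<in> B' #>\<^bsub>K'\<^esub> f x"
      then obtain b' where b: "b' \<in> B'" "z = b' \<otimes>\<^bsub>K'\<^esub> f x" by (auto simp: r_coset_def)
      then have "z = b' \<otimes>\<^bsub>K'\<^esub> (f \<one>\<^bsub>K\<^esub> \<otimes>\<^bsub>K'\<^esub> f x)" using fx by (simp add: one)
      then show "z \<in> B' <#>\<^bsub>K'\<^esub> (\<lambda>b. f b \<otimes>\<^bsub>K'\<^esub> f x) ` B"
        using b(1) B.one_closed unfolding set_mult_def by blast
    qed
  qed
qed

text \<open>The relation \<open>R\<close> stands for a homomorphism known only up to choices of representatives,
  such as the connecting map.\<close>

lemma Mod_group_hom:
  assumes K: "comm_group K" and B: "subgroup B K"
    and K': "comm_group K'" and B': "subgroup B' K'"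
    and total: "\<And>x. x \<in> carrier K \<Longrightarrow> \<exists>y\<in>carrier K'. R x y"
    and mult: "\<And>x y x' y'. x \<in> carrier K \<Longrightarrow> y \<in> carrier K' \<Longrightarrow> x' \<in> carrier K \<Longrightarrow>
      y' \<in> carrier K' \<Longrightarrow> R x y \<Longrightarrow> R x' y' \<Longrightarrow> R (x \<otimes>\<^bsub>K\<^esub> x') (y \<otimes>\<^bsub>K'\<^esub> y')"
    and F: "\<And>x y. x \<in> carrier K \<Longrightarrow> y \<in> carrier K' \<Longrightarrow> R x y \<Longrightarrow>
      F (B #>\<^bsub>K\<^esub> x) = B' #>\<^bsub>K'\<^esub> y"
  shows "group_hom (K Mod B) (K' Mod B') F"
proof -
  interpret K: comm_group K by fact
  interpret K': comm_group K' by fact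
  interpret KB: comm_group "K Mod B" by (rule Mod_comm_group) fact+
  interpret KB': comm_group "K' Mod B'" by (rule Mod_comm_group) fact+
  have "F \<in> hom (K Mod B) (K' Mod B')"
  proof (rule homI)
    fix S assume "S \<in> carrier (K Mod B)"
    then obtain x where x: "x \<in> carrier K" "S = B #>\<^bsub>K\<^esub> x" by (auto simp: carrier_FactGroup)
    with total obtain y where "y \<in> carrier K'" "R x y" by blast
    with x F show "F S \<in> carrier (K' Mod B')" by (auto simp: carrier_FactGroup)
  next
    fix S S' assume "S \<in> carrier (K Mod B)" "S' \<in> carrier (K Mod B)"
    then obtain x x' where x: "x \<in> carrier K" "S = B #>\<^bsub>K\<^esub> x" "x' \<in> carrier K" "S' = B #>\<^bsub>K\<^esub> x'"
      by (auto simp: carrier_FactGroup)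
    then obtain y y' where y: "y \<in> carrier K'" "R x y" "y' \<in> carrier K'" "R x' y'"
      using total by metis
    then have "R (x \<otimes>\<^bsub>K\<^esub> x') (y \<otimes>\<^bsub>K'\<^esub> y')" using x mult by blast
    then show "F (S \<otimes>\<^bsub>K Mod B\<^esub> S') = F S \<otimes>\<^bsub>K' Mod B'\<^esub> F S'"
      using x y by (simp add: Mod_mult assms F)
  qed
  then show ?thesis by unfold_locales
qed

section \<open>Cohomology of a cochain complex and induced maps\<close>

locale cochain_complex =
  fixes K :: "int \<Rightarrow> 'a monoid" and d :: "int \<Rightarrow> 'a \<Rightarrow> 'a"
  assumes comm_group_K: "comm_group (K n)"
    and d_hom: "d n \<in> hom (K n) (K (n + 1))"
    and d_d: "x \<in> carrier (K n) \<Longrightarrow> d (n + 1) (d n x) = \<one>\<^bsub>K (n + 1 + 1)\<^esub>"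
begin

sublocale K: comm_group "K n" for n by (rule comm_group_K)

sublocale d: group_hom "K n" "K (n + 1)" "d n" for n
  by unfold_locales (rule d_hom)

definition "Z n = kernel (K n) (K (n + 1)) (d n)"
definition "B n = d (n - 1) ` carrier (K (n - 1))"
text \<open>The cocycles as a group, in the form used by \<open>cohomology\<close>, so that
  \<open>ZK n Mod B n\<close> becomes the cohomology group by unfolding.\<close>

definition "ZK n = (K n)\<lparr>carrier := Z n\<rparr>"

lemma Z_iff: "x \<in> Z n \<longleftrightarrow> x \<in> carrier (K n) \<and> d n x = \<one>\<^bsub>K (n + 1)\<^esub>"
  by (simp add: Z_def kernel_def)

lemma B_Suc: "B (n + 1) = d n ` carrier (K n)"
  by (simp add: B_def)

lemma d_B: "y \<in> carrier (K n) \<Longrightarrow> d n y \<in> B (n + 1)"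
  by (simp add: B_Suc)

lemma subgroup_Z: "subgroup (Z n) (K n)"
  unfolding Z_def by (rule d.subgroup_kernel)

lemma comm_group_ZK: "comm_group (ZK n)"
proof -
  interpret subgroup "Z n" "K n" by (rule subgroup_Z)
  show ?thesis
    unfolding ZK_def
    by (rule group.group_comm_groupI[OF K.subgroup_imp_group[OF subgroup_Z]])
      (auto simp: K.m_comm)
qed

lemma ZK_simps [simp]:
  "carrier (ZK n) = Z n" "x \<otimes>\<^bsub>ZK n\<^esub> y = x \<otimes>\<^bsub>K n\<^esub> y" "\<one>\<^bsub>ZK n\<^esub> = \<one>\<^bsub>K n\<^esub>"
  "S #>\<^bsub>ZK n\<^esub> x = S #>\<^bsub>K n\<^esub> x" "S <#>\<^bsub>ZK n\<^esub> S' = S <#>\<^bsub>K n\<^esub> S'"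
  by (simp_all add: ZK_def)

lemma subgroup_B: "subgroup (B n) (ZK n)"
proof -
  \<comment> \<open>\<open>B n\<close> refers to degree \<open>n - 1\<close>, while \<open>d\<close>
    is handled as a map into degree \<open>n + 1\<close>. Writing the integer \<open>n\<close> as
    \<open>m + 1\<close> reconciles the two.\<close>
  obtain m where n: "n = m + 1" by (metis diff_add_cancel)
  have "B n \<subseteq> Z n" by (auto simp: n B_Suc Z_iff d_d)
  then show ?thesis
    unfolding ZK_def
    using K.subgroup_incl[OF _ subgroup_Z, of "B n"] d.img_is_subgroup[of m]
    by (simp add: n B_Suc)
qed

lemma carrier_H: "carrier (ZK n Mod B n) = (\<lambda>x. B n #>\<^bsub>K n\<^esub> x) ` Z n"
  by (simp add: carrier_FactGroup)

lemma H_eq_iff: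
  assumes "x \<in> Z n" "y \<in> Z n"
  shows "B n #>\<^bsub>K n\<^esub> x = B n #>\<^bsub>K n\<^esub> y \<longleftrightarrow> (\<exists>b\<in>B n. y = b \<otimes>\<^bsub>K n\<^esub> x)"
  using Mod_eq_iff[OF comm_group_ZK subgroup_B, of x n y] assms by simp

lemma H_one_iff:
  assumes "x \<in> Z n"
  shows "B n #>\<^bsub>K n\<^esub> x = B n \<longleftrightarrow> x \<in> B n"
  using Mod_eq_one_iff[OF comm_group_ZK subgroup_B, of x n] assms by simp

text \<open>The identity of a quotient group is the subgroup itself, whence the equation with
  \<open>B'\<close>. The target is left arbitrary so that both \<open>H_map\<close> and the
  connecting map are covered.\<close>

lemma kernel_H:
  "kernel (ZK n Mod B n) (L Mod B') h = {B n #>\<^bsub>K n\<^esub> x | x. x \<in> Z n \<and> h (B n #>\<^bsub>K n\<^esub> x) = B'}"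
  by (auto simp: kernel_def carrier_H)

end

locale cochain_map = K: cochain_complex K dK + L: cochain_complex L dL
  for K :: "int \<Rightarrow> 'a monoid" and dK and L :: "int \<Rightarrow> 'b monoid" and dL +
  fixes f :: "int \<Rightarrow> 'a \<Rightarrow> 'b"
  assumes f_hom: "f n \<in> hom (K n) (L n)"
    and f_d: "x \<in> carrier (K n) \<Longrightarrow> f (n + 1) (dK n x) = dL n (f n x)"
begin

sublocale f: group_hom "K n" "L n" "f n" for n
  by unfold_locales (rule f_hom)

lemma f_Z: "x \<in> K.Z n \<Longrightarrow> f n x \<in> L.Z n"
  by (auto simp: K.Z_iff L.Z_iff simp flip: f_d)

definition "H_map n S = L.B n <#>\<^bsub>L n\<^esub> (f n ` S)"

lemma f_B: "x \<in> K.B n \<Longrightarrow> f n x \<in> L.B n"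
  by (cases "\<exists>m. n = m + 1") (auto simp: K.B_Suc L.B_Suc f_d, metis diff_add_cancel)

lemma f_hom_ZK: "f n \<in> hom (K.ZK n) (L.ZK n)"
  by (rule homI) (auto simp: f_Z, simp add: K.Z_iff)

lemma H_map_coset: "x \<in> K.Z n \<Longrightarrow> H_map n (K.B n #>\<^bsub>K n\<^esub> x) = L.B n #>\<^bsub>L n\<^esub> f n x"
  unfolding H_map_def
  using Mod_map_coset[OF K.comm_group_ZK K.subgroup_B L.comm_group_ZK L.subgroup_B f_hom_ZK, of n x]
  by (simp add: f_B image_subset_iff)

lemma H_map_hom: "group_hom (K.ZK n Mod K.B n) (L.ZK n Mod L.B n) (H_map n)"
proof (rule Mod_group_hom[where R = "\<lambda>x y. y = f n x",
      OF K.comm_group_ZK K.subgroup_B L.comm_group_ZK L.subgroup_B])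
  show "\<exists>y\<in>carrier (L.ZK n). y = f n x" if "x \<in> carrier (K.ZK n)" for x
    using that f_Z by auto
qed (auto simp: H_map_coset K.Z_iff)

end

section \<open>The connecting map and exactness at the three places\<close>

text \<open>Dualizing reverses arrows: \<open>P\<close>, \<open>K\<close>, \<open>L\<close> will be
  the cochains of the quotient complex, of the whole complex and of the subcomplex, with
  \<open>f\<close> dual to the quotient map and \<open>g\<close> the restriction of
  cochains.\<close>

locale short_exact_cochains =
  f: cochain_map P dP K dK f + g: cochain_map K dK L dL g
  for P :: "int \<Rightarrow> 'p monoid" and dP and K :: "int \<Rightarrow> 'k monoid" and dK
    and L :: "int \<Rightarrow> 'l monoid" and dL and f g +
  assumes f_inj: "inj_on (f n) (carrier (P n))"
    and ker_g: "x \<in> carrier (K n) \<Longrightarrow> g n x = \<one>\<^bsub>L n\<^esub> \<longleftrightarrow> x \<in> f n ` carrier (P n)"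
    and g_surj: "g n ` carrier (K n) = carrier (L n)"
begin

text \<open>Same choice-free shape as \<open>connecting_map\<close>, so that the two agree by
  unfolding. That the collected values form a single coset is \<open>delta_coset\<close>.\<close>

definition "delta n S = {\<psi> \<in> carrier (P (n + 1)). \<exists>\<phi> \<in> carrier (K n). g n \<phi> \<in> S \<and> f (n + 1) \<psi> = dK n \<phi>}"

lemma f_eq_one: "x \<in> carrier (P n) \<Longrightarrow> f n x = \<one>\<^bsub>K n\<^esub> \<Longrightarrow> x = \<one>\<^bsub>P n\<^esub>"
  using f_inj[of n] by (metis f.K.K.one_closed f.f.hom_one inj_onD)

lemma g_f: "x \<in> carrier (P n) \<Longrightarrow> g n (f n x) = \<one>\<^bsub>L n\<^esub>"
  using ker_g by auto

text \<open>Injectivity of \<open>f\<close> in the next degree reflects the cocycle condition, since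
  \<open>f\<close> commutes with the coboundaries.\<close>

lemma f_Z_iff: "x \<in> carrier (P n) \<Longrightarrow> f n x \<in> f.L.Z n \<Longrightarrow> x \<in> f.K.Z n"
  using f_eq_one[of "dP n x" "n+1"] by (auto simp: f.L.Z_iff f.K.Z_iff f.f_d)

text \<open>The zigzag: lift \<open>l\<close> to \<open>k\<close> by surjectivity of
  \<open>g\<close>; the coboundary of \<open>k\<close> dies under \<open>g\<close>, hence comes from
  some \<open>p\<close>; and \<open>p\<close> is a cocycle because \<open>f p\<close> is a
  coboundary and \<open>f\<close> is injective.\<close>

lemma lift_ex:
  assumes "l \<in> g.L.Z n"
  shows "\<exists>p\<in>f.K.Z (n + 1). \<exists>k\<in>carrier (K n). g n k = l \<and> f (n + 1) p = dK n k"
proof -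
  obtain k where k: "k \<in> carrier (K n)" "g n k = l"
    using assms g_surj[of n] by (metis g.L.Z_iff imageE)
  then have "g (n + 1) (dK n k) = \<one>\<^bsub>L (n + 1)\<^esub>"
    using assms by (simp add: g.f_d g.L.Z_iff)
  then obtain p where p: "p \<in> carrier (P (n + 1))" "f (n + 1) p = dK n k"
    using ker_g[of "dK n k" "n + 1"] k by auto
  moreover have "p \<in> f.K.Z (n + 1)"
    using f_Z_iff[OF p(1)] p k by (auto simp: f.L.Z_iff f.L.d_d)
  ultimately show ?thesis using k by blast
qed

text \<open>Another lift of another representative differs from \<open>k\<close> by a coboundary and
  an element of the image of \<open>f\<close>. The coboundary is killed by \<open>dK\<close>, and
  the element \<open>f n s\<close> changes \<open>p\<close> by \<open>dP n s\<close>. Conversely,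
  changing \<open>k\<close> by \<open>f n s\<close> reaches every member of the coset of
  \<open>p\<close>.\<close>

lemma delta_coset:
  assumes p: "p \<in> f.K.Z (n + 1)" and k: "k \<in> carrier (K n)" and fp: "f (n + 1) p = dK n k"
    and l: "g n k \<in> g.L.Z n"
  shows "delta n (g.L.B n #>\<^bsub>L n\<^esub> g n k) = f.K.B (n + 1) #>\<^bsub>P (n + 1)\<^esub> p"
proof (intro equalityI subsetI)
  have pc: "p \<in> carrier (P (n + 1))" using p by (simp add: f.K.Z_iff)
  fix \<psi>
  {
    assume "\<psi> \<in> delta n (g.L.B n #>\<^bsub>L n\<^esub> g n k)"
    then obtain \<phi> b where psi: "\<psi> \<in> carrier (P (n + 1))" "\<phi> \<in> carrier (K n)" "b \<in> g.L.B n"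
      "g n \<phi> = b \<otimes>\<^bsub>L n\<^esub> g n k" "f (n + 1) \<psi> = dK n \<phi>"
      by (auto simp: delta_def r_coset_def)
    obtain m where n: "n = m + 1" by (metis diff_add_cancel)
    obtain y' where y': "y' \<in> carrier (L m)" "b = dL m y'"
      using psi(3) by (auto simp: n g.L.B_Suc)
    then obtain y where y: "y \<in> carrier (K m)" "y' = g m y"
      using g_surj[of m] by auto
    have yc: "dK m y \<in> carrier (K n)" using y by (simp add: n)
    have b: "b = g n (dK m y)" using y y' by (simp add: n g.f_d)
    \<comment> \<open>The coboundary \<open>b\<close> has been lifted to \<open>dK m y\<close>. Once
      this is taken into account, \<open>\<phi>\<close> and \<open>k\<close> have the same image
      under \<open>g\<close>, so the quotient of the two comes from some \<open>s\<close> in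
      \<open>P n\<close>.\<close>
    have "g n (\<phi> \<otimes>\<^bsub>K n\<^esub> inv\<^bsub>K n\<^esub> (dK m y \<otimes>\<^bsub>K n\<^esub> k)) = \<one>\<^bsub>L n\<^esub>"
      using yc k psi(2) by (simp add: psi(4) b)
    then obtain s where s: "s \<in> carrier (P n)" "\<phi> \<otimes>\<^bsub>K n\<^esub> inv\<^bsub>K n\<^esub> (dK m y \<otimes>\<^bsub>K n\<^esub> k) = f n s"
      using ker_g[of "\<phi> \<otimes>\<^bsub>K n\<^esub> inv\<^bsub>K n\<^esub> (dK m y \<otimes>\<^bsub>K n\<^esub> k)" n] yc k psi(2) by auto
    have fs: "f n s \<in> carrier (K n)" using s(1) by simp
    have phi: "\<phi> = f n s \<otimes>\<^bsub>K n\<^esub> (dK m y \<otimes>\<^bsub>K n\<^esub> k)"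
      using yc k psi(2) by (simp flip: s(2) add: f.L.K.m_assoc)
    have "dK n (dK m y) = \<one>\<^bsub>K (n + 1)\<^esub>" using y f.L.d_d by (simp add: n)
    then have "dK n \<phi> = dK n (f n s) \<otimes>\<^bsub>K (n + 1)\<^esub> dK n k"
      using yc k s by (simp add: phi)
    also have "\<dots> = f (n + 1) (dP n s \<otimes>\<^bsub>P (n + 1)\<^esub> p)"
      using s pc by (simp add: f.f_d fp)
    finally have "\<psi> = dP n s \<otimes>\<^bsub>P (n + 1)\<^esub> p"
      using inj_onD[OF f_inj[of "n + 1"]] psi(1,5) s pc by simp
    then show "\<psi> \<in> f.K.B (n + 1) #>\<^bsub>P (n + 1)\<^esub> p"
      using s by (auto simp: r_coset_def f.K.B_Suc)
  next
    assume "\<psi> \<in> f.K.B (n + 1) #>\<^bsub>P (n + 1)\<^esub> p"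
    then obtain s where s: "s \<in> carrier (P n)" "\<psi> = dP n s \<otimes>\<^bsub>P (n + 1)\<^esub> p"
      by (auto simp: r_coset_def f.K.B_Suc)
    have gk: "g n k \<in> carrier (L n)" using k by simp
    \<comment> \<open>The witness for membership in \<open>delta\<close> is \<open>k\<close>
      multiplied by \<open>f n s\<close>: its image under \<open>g\<close> is unchanged, and its
      coboundary is the image of \<open>\<psi>\<close>.\<close>
    have "g n (f n s \<otimes>\<^bsub>K n\<^esub> k) = g n k" using s k by (simp add: g_f)
    moreover have "g n k \<in> g.L.B n #>\<^bsub>L n\<^esub> g n k"
      using subgroup.one_closed[OF g.L.subgroup_B[of n]] gk by (force simp: r_coset_def)
    moreover have "f (n + 1) \<psi> = dK n (f n s \<otimes>\<^bsub>K n\<^esub> k)"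
      using s pc k by (simp add: f.f_d fp)
    ultimately show "\<psi> \<in> delta n (g.L.B n #>\<^bsub>L n\<^esub> g n k)"
      using s pc k by (auto simp: delta_def intro!: bexI[of _ "f n s \<otimes>\<^bsub>K n\<^esub> k"])
  }
qed

text \<open>The relation joins \<open>l\<close> to every end \<open>p\<close> of a zigzag starting
  at \<open>l\<close>. It is total by \<open>lift_ex\<close>, multiplicative because products of
  lifts are lifts, and it determines the coset by \<open>delta_coset\<close>.\<close>

lemma delta_hom: "group_hom (g.L.ZK n Mod g.L.B n) (f.K.ZK (n + 1) Mod f.K.B (n + 1)) (delta n)"
proof (rule Mod_group_hom[where R = "\<lambda>l p. \<exists>k\<in>carrier (K n). g n k = l \<and> f (n + 1) p = dK n k",
      OF g.L.comm_group_ZK g.L.subgroup_B f.K.comm_group_ZK f.K.subgroup_B])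
  fix l p l' p'
  assume *: "l \<in> carrier (g.L.ZK n)" "p \<in> carrier (f.K.ZK (n + 1))"
    "l' \<in> carrier (g.L.ZK n)" "p' \<in> carrier (f.K.ZK (n + 1))"
    "\<exists>k\<in>carrier (K n). g n k = l \<and> f (n + 1) p = dK n k"
    "\<exists>k\<in>carrier (K n). g n k = l' \<and> f (n + 1) p' = dK n k"
  then obtain k k' where "k \<in> carrier (K n)" "g n k = l" "f (n + 1) p = dK n k"
    "k' \<in> carrier (K n)" "g n k' = l'" "f (n + 1) p' = dK n k'" by blast
  then show "\<exists>k\<in>carrier (K n). g n k = l \<otimes>\<^bsub>g.L.ZK n\<^esub> l' \<and>
      f (n + 1) (p \<otimes>\<^bsub>f.K.ZK (n + 1)\<^esub> p') = dK n k"
    using * by (intro bexI[of _ "k \<otimes>\<^bsub>K n\<^esub> k'"]) (auto simp: f.K.Z_iff)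
qed (use lift_ex delta_coset in auto)

text \<open>If \<open>g n x\<close> is the coboundary of \<open>y'\<close>, lift \<open>y'\<close>
  to \<open>y\<close>. Dividing \<open>x\<close> by \<open>dK m y\<close> keeps its class and makes
  its image under \<open>g\<close> trivial, so the new representative comes from
  \<open>P\<close>.\<close>

lemma exact_K:
  "exact_at (f.K.ZK n Mod f.K.B n) (f.H_map n) (f.L.ZK n Mod f.L.B n) (g.H_map n) (g.L.ZK n Mod g.L.B n)"
  unfolding exact_at_def
proof (intro conjI f.H_map_hom g.H_map_hom)
  show "kernel (f.L.ZK n Mod f.L.B n) (g.L.ZK n Mod g.L.B n) (g.H_map n) =
    f.H_map n ` carrier (f.K.ZK n Mod f.K.B n)"
    unfolding f.L.kernel_H f.K.carrier_H
  proof (intro equalityI subsetI)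
    fix S assume "S \<in> {f.L.B n #>\<^bsub>K n\<^esub> x |x. x \<in> f.L.Z n \<and> g.H_map n (f.L.B n #>\<^bsub>K n\<^esub> x) = g.L.B n}"
    then obtain x where x: "S = f.L.B n #>\<^bsub>K n\<^esub> x" "x \<in> f.L.Z n"
      "g.H_map n (f.L.B n #>\<^bsub>K n\<^esub> x) = g.L.B n" by blast
    then have "g n x \<in> g.L.B n"
      by (simp add: g.H_map_coset g.L.H_one_iff g.f_Z)
    moreover obtain m where n: "n = m + 1" by (metis diff_add_cancel)
    ultimately obtain y' where y': "y' \<in> carrier (L m)" "g n x = dL m y'"
      by (auto simp: n g.L.B_Suc)
    then obtain y where y: "y \<in> carrier (K m)" "y' = g m y"
      using g_surj[of m] by auto
    have xc: "x \<in> carrier (K n)" "dK n x = \<one>\<^bsub>K (n + 1)\<^esub>" using x by (auto simp: f.L.Z_iff)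
    have yc: "dK m y \<in> carrier (K n)" "dK n (dK m y) = \<one>\<^bsub>K (n + 1)\<^esub>"
      using y f.L.d_d by (simp_all add: n)
    have "g n x = g n (dK m y)" using y' y by (simp add: n g.f_d)
    then have "g n (x \<otimes>\<^bsub>K n\<^esub> inv\<^bsub>K n\<^esub> dK m y) = \<one>\<^bsub>L n\<^esub>"
      using xc yc by simp
    then obtain p where p: "p \<in> carrier (P n)" "f n p = x \<otimes>\<^bsub>K n\<^esub> inv\<^bsub>K n\<^esub> dK m y"
      using ker_g[of "x \<otimes>\<^bsub>K n\<^esub> inv\<^bsub>K n\<^esub> dK m y" n] xc yc by auto
    \<comment> \<open>\<open>p\<close> was obtained only as a cochain. Its image is a quotient of
      two cocycles, so \<open>f_Z_iff\<close> makes \<open>p\<close> a cocycle too.\<close>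
    have "f n p \<in> f.L.Z n"
      using xc yc by (simp add: p f.L.Z_iff)
    then have pZ: "p \<in> f.K.Z n" using p f_Z_iff by blast
    have "x = dK m y \<otimes>\<^bsub>K n\<^esub> f n p"
      using xc yc f.L.K.inv_solve_right'[of "f n p" n x "dK m y"] p
      by (metis f.L.K.inv_closed f.L.K.m_closed f.L.K.m_comm)
    moreover have "dK m y \<in> f.L.B n" using y by (simp add: n f.L.d_B)
    ultimately have "f.L.B n #>\<^bsub>K n\<^esub> f n p = f.L.B n #>\<^bsub>K n\<^esub> x"
      using f.L.H_eq_iff x pZ f.f_Z by blast
    then have "S = f.H_map n (f.K.B n #>\<^bsub>P n\<^esub> p)"
      using pZ x by (simp add: f.H_map_coset)
    then show "S \<in> f.H_map n ` (#>\<^bsub>P n\<^esub>) (f.K.B n) ` f.K.Z n" using pZ by blast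
  next
    fix S assume "S \<in> f.H_map n ` (#>\<^bsub>P n\<^esub>) (f.K.B n) ` f.K.Z n"
    then obtain p where p: "p \<in> f.K.Z n" "S = f.L.B n #>\<^bsub>K n\<^esub> f n p"
      by (auto simp: f.H_map_coset)
    then have "g n (f n p) = \<one>\<^bsub>L n\<^esub>" by (simp add: g_f f.K.Z_iff)
    then have "g.H_map n S = g.L.B n"
      using p f.f_Z[of p n] subgroup.one_closed[OF g.L.subgroup_B[of n]]
        g.L.H_one_iff[OF g.f_Z[OF f.f_Z[OF p(1)]]]
      by (simp add: g.H_map_coset)
    then show "S \<in> {f.L.B n #>\<^bsub>K n\<^esub> x |x. x \<in> f.L.Z n \<and> g.H_map n (f.L.B n #>\<^bsub>K n\<^esub> x) = g.L.B n}"
      using p f.f_Z by blast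
  qed
qed

text \<open>If the zigzag from \<open>l\<close> ends in a coboundary \<open>dP n s\<close>, dividing
  the lift \<open>k\<close> by \<open>f n s\<close> yields a cocycle that still lies over
  \<open>l\<close>.\<close>

lemma exact_L:
  "exact_at (f.L.ZK n Mod f.L.B n) (g.H_map n) (g.L.ZK n Mod g.L.B n) (delta n)
    (f.K.ZK (n + 1) Mod f.K.B (n + 1))"
  unfolding exact_at_def
proof (intro conjI g.H_map_hom delta_hom)
  show "kernel (g.L.ZK n Mod g.L.B n) (f.K.ZK (n + 1) Mod f.K.B (n + 1)) (delta n) =
    g.H_map n ` carrier (f.L.ZK n Mod f.L.B n)"
    unfolding g.L.kernel_H f.L.carrier_H
  proof (intro equalityI subsetI)
    fix S assume "S \<in> {g.L.B n #>\<^bsub>L n\<^esub> x |x. x \<in> g.L.Z n \<and> delta n (g.L.B n #>\<^bsub>L n\<^esub> x) = f.K.B (n + 1)}"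
    then obtain l where l: "S = g.L.B n #>\<^bsub>L n\<^esub> l" "l \<in> g.L.Z n"
      "delta n (g.L.B n #>\<^bsub>L n\<^esub> l) = f.K.B (n + 1)" by blast
    obtain p k where p: "p \<in> f.K.Z (n + 1)" and k: "k \<in> carrier (K n)" "g n k = l"
      and fp: "f (n + 1) p = dK n k"
      using lift_ex[OF l(2)] by blast
    have "f.K.B (n + 1) #>\<^bsub>P (n + 1)\<^esub> p = f.K.B (n + 1)"
      using delta_coset[OF p k(1) fp] l k by simp
    then have "p \<in> f.K.B (n + 1)"
      using p by (simp add: f.K.H_one_iff)
    then obtain s where s: "s \<in> carrier (P n)" "p = dP n s" by (auto simp: f.K.B_Suc)
    have sk: "f n s \<in> carrier (K n)" "dK n (f n s) = dK n k"
      using s fp by (simp_all add: f.f_d)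
    define k' where "k' = k \<otimes>\<^bsub>K n\<^esub> inv\<^bsub>K n\<^esub> f n s"
    have "l \<in> carrier (L n)" using k by auto
    then have "k' \<in> f.L.Z n" "g n k' = l"
      using k sk s by (simp_all add: k'_def f.L.Z_iff g_f)
    then have "S = g.H_map n (f.L.B n #>\<^bsub>K n\<^esub> k')" "k' \<in> f.L.Z n"
      using l by (simp_all add: g.H_map_coset)
    then show "S \<in> g.H_map n ` (#>\<^bsub>K n\<^esub>) (f.L.B n) ` f.L.Z n" by blast
  next
    fix S assume "S \<in> g.H_map n ` (#>\<^bsub>K n\<^esub>) (f.L.B n) ` f.L.Z n"
    then obtain k where k: "k \<in> f.L.Z n" "S = g.L.B n #>\<^bsub>L n\<^esub> g n k"
      by (auto simp: g.H_map_coset)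
    \<comment> \<open>A cocycle \<open>k\<close> serves as its own lift. Its coboundary is trivial,
      so the zigzag ends at the identity.\<close>
    have one: "\<one>\<^bsub>P (n + 1)\<^esub> \<in> f.K.Z (n + 1)" by (simp add: f.K.Z_iff)
    have "delta n S = f.K.B (n + 1) #>\<^bsub>P (n + 1)\<^esub> \<one>\<^bsub>P (n + 1)\<^esub>"
      unfolding k(2) using k(1) by (intro delta_coset one g.f_Z) (auto simp: f.L.Z_iff)
    also have "\<dots> = f.K.B (n + 1)"
      using f.K.H_one_iff[OF one] subgroup.one_closed[OF f.K.subgroup_B[of "n + 1"]] by simp
    finally show "S \<in> {g.L.B n #>\<^bsub>L n\<^esub> x |x. x \<in> g.L.Z n \<and> delta n (g.L.B n #>\<^bsub>L n\<^esub> x) = f.K.B (n + 1)}"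
      using k g.f_Z by blast
  qed
qed

text \<open>An equation \<open>f (n + 1) p = dK n k\<close> is a zigzag read from either end: it
  says that the class of \<open>p\<close> dies in \<open>K\<close>, and that \<open>p\<close>
  represents the value of \<open>delta\<close> at the class of \<open>g n k\<close>.\<close>

lemma exact_P:
  "exact_at (g.L.ZK n Mod g.L.B n) (delta n) (f.K.ZK (n + 1) Mod f.K.B (n + 1)) (f.H_map (n + 1))
    (f.L.ZK (n + 1) Mod f.L.B (n + 1))"
  unfolding exact_at_def
proof (intro conjI f.H_map_hom delta_hom)
  show "kernel (f.K.ZK (n + 1) Mod f.K.B (n + 1)) (f.L.ZK (n + 1) Mod f.L.B (n + 1)) (f.H_map (n + 1)) =
    delta n ` carrier (g.L.ZK n Mod g.L.B n)"
    unfolding f.K.kernel_H g.L.carrier_H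
  proof (intro equalityI subsetI)
    fix S assume "S \<in> {f.K.B (n + 1) #>\<^bsub>P (n + 1)\<^esub> x |x. x \<in> f.K.Z (n + 1) \<and>
      f.H_map (n + 1) (f.K.B (n + 1) #>\<^bsub>P (n + 1)\<^esub> x) = f.L.B (n + 1)}"
    then obtain p where p: "S = f.K.B (n + 1) #>\<^bsub>P (n + 1)\<^esub> p" "p \<in> f.K.Z (n + 1)"
      "f.H_map (n + 1) (f.K.B (n + 1) #>\<^bsub>P (n + 1)\<^esub> p) = f.L.B (n + 1)" by blast
    then have "f (n + 1) p \<in> f.L.B (n + 1)"
      by (simp add: f.H_map_coset f.L.H_one_iff f.f_Z)
    then obtain k where k: "k \<in> carrier (K n)" "f (n + 1) p = dK n k" by (auto simp: f.L.B_Suc)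
    have "dL n (g n k) = g (n + 1) (f (n + 1) p)"
      using k by (simp add: g.f_d)
    also have "\<dots> = \<one>\<^bsub>L (n + 1)\<^esub>" using p(2) by (simp add: f.K.Z_iff g_f)
    finally have "g n k \<in> g.L.Z n" using k by (simp add: g.L.Z_iff)
    moreover from this have "S = delta n (g.L.B n #>\<^bsub>L n\<^esub> g n k)"
      using delta_coset p k by simp
    ultimately show "S \<in> delta n ` (#>\<^bsub>L n\<^esub>) (g.L.B n) ` g.L.Z n" by blast
  next
    fix S assume "S \<in> delta n ` (#>\<^bsub>L n\<^esub>) (g.L.B n) ` g.L.Z n"
    then obtain l where l: "l \<in> g.L.Z n" "S = delta n (g.L.B n #>\<^bsub>L n\<^esub> l)" by blast
    obtain p k where p: "p \<in> f.K.Z (n + 1)" and k: "k \<in> carrier (K n)" "g n k = l"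
      and fp: "f (n + 1) p = dK n k"
      using lift_ex[OF l(1)] by blast
    have "S = f.K.B (n + 1) #>\<^bsub>P (n + 1)\<^esub> p"
      using delta_coset[OF p k(1) fp] l k by simp
    moreover have "f.H_map (n + 1) (f.K.B (n + 1) #>\<^bsub>P (n + 1)\<^esub> p) = f.L.B (n + 1)"
      using p k fp f.L.H_one_iff[OF f.f_Z[OF p]] by (simp add: f.H_map_coset f.L.d_B)
    ultimately show "S \<in> {f.K.B (n + 1) #>\<^bsub>P (n + 1)\<^esub> x |x. x \<in> f.K.Z (n + 1) \<and>
      f.H_map (n + 1) (f.K.B (n + 1) #>\<^bsub>P (n + 1)\<^esub> x) = f.L.B (n + 1)}"
      using p by blast
  qed
qed

end

section \<open>Cochains with coefficients\<close>

lemma hom_group_simps: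
  "carrier (hom_group H G) = hom H G \<inter> extensional (carrier H)"
  "\<phi> \<otimes>\<^bsub>hom_group H G\<^esub> \<psi> = restrict (\<lambda>x. \<phi> x \<otimes>\<^bsub>G\<^esub> \<psi> x) (carrier H)"
  "\<one>\<^bsub>hom_group H G\<^esub> = restrict (\<lambda>x. \<one>\<^bsub>G\<^esub>) (carrier H)"
  by (simp_all add: hom_group_def)

text \<open>Commutativity of \<open>G\<close> makes pointwise products and inverses homomorphisms
  again; extensionality turns pointwise laws into equations of functions.\<close>

lemma comm_group_hom_group:
  assumes H: "group H" and G: "comm_group G"
  shows "comm_group (hom_group H G)"
proof -
  interpret H: group H by fact
  interpret G: comm_group G by fact
  have cl: "\<phi> x \<in> carrier G" if "\<phi> \<in> hom H G" "x \<in> carrier H" for \<phi> x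
    using that by (rule hom_in_carrier)
  have mult: "\<phi> (x \<otimes>\<^bsub>H\<^esub> y) = \<phi> x \<otimes>\<^bsub>G\<^esub> \<phi> y" if "\<phi> \<in> hom H G" "x \<in> carrier H" "y \<in> carrier H" for \<phi> x y
    using that by (rule hom_mult)
  show ?thesis
  proof (rule comm_groupI)
    fix \<phi> assume phi: "\<phi> \<in> carrier (hom_group H G)"
    then have hom: "\<phi> \<in> hom H G" by (simp add: hom_group_simps)
    have "restrict (\<lambda>x. inv\<^bsub>G\<^esub> \<phi> x) (carrier H) \<in> carrier (hom_group H G)"
      unfolding hom_group_simps
      by (auto intro!: homI simp: cl[OF hom] mult[OF hom] G.inv_mult)
    moreover have "restrict (\<lambda>x. inv\<^bsub>G\<^esub> \<phi> x) (carrier H) \<otimes>\<^bsub>hom_group H G\<^esub> \<phi> = \<one>\<^bsub>hom_group H G\<^esub>"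
      by (auto simp: hom_group_simps cl[OF hom])
    ultimately show "\<exists>\<psi>\<in>carrier (hom_group H G). \<psi> \<otimes>\<^bsub>hom_group H G\<^esub> \<phi> = \<one>\<^bsub>hom_group H G\<^esub>"
      by (intro bexI)
    show "\<one>\<^bsub>hom_group H G\<^esub> \<otimes>\<^bsub>hom_group H G\<^esub> \<phi> = \<phi>"
      using phi cl[OF hom] by (auto simp: hom_group_simps extensional_def)
  next
    show "\<one>\<^bsub>hom_group H G\<^esub> \<in> carrier (hom_group H G)"
      by (auto simp: hom_group_simps intro!: homI)
  next
    fix \<phi> \<psi> assume "\<phi> \<in> carrier (hom_group H G)" "\<psi> \<in> carrier (hom_group H G)"
    then have hom: "\<phi> \<in> hom H G" "\<psi> \<in> hom H G" by (simp_all add: hom_group_simps)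
    show "\<phi> \<otimes>\<^bsub>hom_group H G\<^esub> \<psi> \<in> carrier (hom_group H G)"
      by (auto simp: hom_group_simps cl[OF hom(1)] cl[OF hom(2)] mult[OF hom(1)] mult[OF hom(2)] G.m_ac
          intro!: homI)
    show "\<phi> \<otimes>\<^bsub>hom_group H G\<^esub> \<psi> = \<psi> \<otimes>\<^bsub>hom_group H G\<^esub> \<phi>"
      by (auto simp: hom_group_simps cl[OF hom(1)] cl[OF hom(2)] G.m_comm)
    fix \<theta> assume "\<theta> \<in> carrier (hom_group H G)"
    then have "\<theta> \<in> hom H G" by (simp add: hom_group_simps)
    with hom show "\<phi> \<otimes>\<^bsub>hom_group H G\<^esub> \<psi> \<otimes>\<^bsub>hom_group H G\<^esub> \<theta> =
        \<phi> \<otimes>\<^bsub>hom_group H G\<^esub> (\<psi> \<otimes>\<^bsub>hom_group H G\<^esub> \<theta>)"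
      by (auto simp: hom_group_simps cl G.m_assoc)
  qed
qed

lemma hom_group_precompose:
  assumes H: "group H" and h: "h \<in> hom H H'"
  shows "(\<lambda>\<phi>. restrict (\<phi> \<circ> h) (carrier H)) \<in> hom (hom_group H' G) (hom_group H G)"
proof -
  interpret H: group H by fact
  have cl: "h x \<in> carrier H'" if "x \<in> carrier H" for x
    using h that by (rule hom_in_carrier)
  moreover have "h (x \<otimes>\<^bsub>H\<^esub> y) = h x \<otimes>\<^bsub>H'\<^esub> h y" if "x \<in> carrier H" "y \<in> carrier H" for x y
    using h that by (rule hom_mult)
  ultimately show ?thesis
    by (intro homI) (auto simp: hom_group_simps hom_def Pi_iff fun_eq_iff)
qed

section \<open>Chain complexes and their duals\<close>

locale algebraic_complex =
  fixes C :: "'c chain_complex"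
  assumes comm_group_grp: "comm_group (grp C n)"
    and bd_hom: "bd C n \<in> hom (grp C n) (grp C (n - 1))"
    and bd_bd: "x \<in> carrier (grp C n) \<Longrightarrow> bd C (n - 1) (bd C n x) = \<one>\<^bsub>grp C (n - 1 - 1)\<^esub>"
begin

sublocale comm_group "grp C n" for n by (rule comm_group_grp)

sublocale bd: group_hom "grp C n" "grp C (n - 1)" "bd C n" for n
  by unfold_locales (rule bd_hom)

end

locale chain_morphism = C: algebraic_complex C + D: algebraic_complex D
  for C :: "'c chain_complex" and D :: "'d chain_complex" +
  fixes f :: "int \<Rightarrow> 'c \<Rightarrow> 'd"
  assumes f_hom: "f n \<in> hom (grp C n) (grp D n)"
    and f_bd: "x \<in> carrier (grp C n) \<Longrightarrow> f (n - 1) (bd C n x) = bd D n (f n x)"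
begin

sublocale f: group_hom "grp C n" "grp D n" "f n" for n
  by unfold_locales (rule f_hom)

end

lemma carrier_cochains:
  "\<phi> \<in> carrier (cochains C G n) \<longleftrightarrow> \<phi> \<in> hom (grp C n) G \<and> \<phi> \<in> extensional (carrier (grp C n))"
  by (simp add: cochains_def hom_group_simps)

lemma one_cochains: "\<one>\<^bsub>cochains C G n\<^esub> = restrict (\<lambda>x. \<one>\<^bsub>G\<^esub>) (carrier (grp C n))"
  by (simp add: cochains_def hom_group_simps)

lemma coboundary_eq:
  "coboundary C n \<phi> = restrict (\<phi> \<circ> bd C (n + 1)) (carrier (grp C (n + 1)))"
  by (simp add: coboundary_def pullback_def)

lemma (in algebraic_complex) cochain_complex_cochains:
  assumes G: "comm_group G"
  shows "cochain_complex (cochains C G) (coboundary C)"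
proof (rule cochain_complex.intro)
  fix n
  interpret G: comm_group G by fact
  show "comm_group (cochains C G n)"
    unfolding cochains_def using is_group G by (rule comm_group_hom_group)
  have bd: "bd C (n + 1) \<in> hom (grp C (n + 1)) (grp C n)"
    using bd_hom[of "n + 1"] by simp
  then show "coboundary C n \<in> hom (cochains C G n) (cochains C G (n + 1))"
    using hom_group_precompose[OF is_group bd, where G = G]
    by (simp add: cochains_def coboundary_eq[abs_def])
  fix \<phi> assume "\<phi> \<in> carrier (cochains C G n)"
  then have phi: "\<phi> \<in> hom (grp C n) G" by (simp add: carrier_cochains)
  interpret phi: group_hom "grp C n" G \<phi> by unfold_locales (rule phi)
  \<comment> \<open>Only the cancellation of \<open>+ 1\<close> against \<open>- 1\<close> is
    applied, which keeps the degree in the shape \<open>n + 1 + 1\<close> of the goal.\<close>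
  have "bd C (n + 1) (bd C (n + 1 + 1) x) = \<one>\<^bsub>grp C n\<^esub>"
    if "x \<in> carrier (grp C (n + 1 + 1))" for x
    using bd_bd[OF that] unfolding add_diff_cancel_right' .
  moreover have "bd C (n + 1 + 1) x \<in> carrier (grp C (n + 1))"
    if "x \<in> carrier (grp C (n + 1 + 1))" for x
    using bd.hom_closed[OF that] unfolding add_diff_cancel_right' .
  ultimately show "coboundary C (n + 1) (coboundary C n \<phi>) = \<one>\<^bsub>cochains C G (n + 1 + 1)\<^esub>"
    by (auto simp: coboundary_eq one_cochains)
qed

lemma (in chain_morphism) cochain_map_pullback:
  assumes G: "comm_group G"
  shows "cochain_map (cochains D G) (coboundary D) (cochains C G) (coboundary C) (pullback C f)"
proof -
  interpret cC: cochain_complex "cochains C G" "coboundary C"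
    by (rule C.cochain_complex_cochains) fact
  interpret cD: cochain_complex "cochains D G" "coboundary D"
    by (rule D.cochain_complex_cochains) fact
  show ?thesis
  proof
    fix n
    show "pullback C f n \<in> hom (cochains D G n) (cochains C G n)"
      using hom_group_precompose[OF C.is_group f_hom, where G = G]
      by (simp add: cochains_def pullback_def[abs_def])
    fix \<phi>
    have "bd C (n + 1) x \<in> carrier (grp C n)" "f n (bd C (n + 1) x) = bd D (n + 1) (f (n + 1) x)"
      if "x \<in> carrier (grp C (n + 1))" for x
      using C.bd.hom_closed[OF that] f_bd[OF that] by simp_all
    then show "pullback C f (n + 1) (coboundary D n \<phi>) = coboundary C n (pullback C f n \<phi>)"
      by (auto simp: pullback_def coboundary_eq)
  qed
qed


lemma quotient_complex_simps [simp]: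
  "grp (quotient_complex C N) n = grp C n Mod N n"
  "bd (quotient_complex C N) n S = N (n - 1) <#>\<^bsub>grp C (n - 1)\<^esub> (bd C n ` S)"
  by (simp_all add: quotient_complex_def)

section \<open>Quotients by subcomplexes\<close>

locale subcomplex = algebraic_complex C for C :: "'c chain_complex" +
  fixes N :: "int \<Rightarrow> 'c set"
  assumes subgroup_N: "subgroup (N n) (grp C n)"
    and bd_N: "bd C n ` N n \<subseteq> N (n - 1)"
begin

lemma bd_coset:
  "x \<in> carrier (grp C n) \<Longrightarrow>
    bd (quotient_complex C N) n (N n #>\<^bsub>grp C n\<^esub> x) = N (n - 1) #>\<^bsub>grp C (n - 1)\<^esub> bd C n x"
  by (simp add: Mod_map_coset[OF comm_group_grp subgroup_N comm_group_grp subgroup_N bd_hom bd_N])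

lemma algebraic_complex_quotient: "algebraic_complex (quotient_complex C N)"
proof (rule algebraic_complex.intro)
  fix n
  show "comm_group (grp (quotient_complex C N) n)"
    by (simp add: Mod_comm_group comm_group_grp subgroup_N)
  have "group_hom (grp C n Mod N n) (grp C (n - 1) Mod N (n - 1)) (bd (quotient_complex C N) n)"
    by (rule Mod_group_hom[where R = "\<lambda>x y. y = bd C n x"])
      (auto simp: comm_group_grp subgroup_N bd_coset simp del: quotient_complex_simps)
  then show "bd (quotient_complex C N) n \<in> hom (grp (quotient_complex C N) n) (grp (quotient_complex C N) (n - 1))"
    by (simp add: group_hom_def group_hom_axioms_def)
  fix S assume "S \<in> carrier (grp (quotient_complex C N) n)"
  then obtain x where x: "x \<in> carrier (grp C n)" "S = N n #>\<^bsub>grp C n\<^esub> x"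
    by (auto simp: carrier_FactGroup)
  have "N (n - 1 - 1) #>\<^bsub>grp C (n - 1 - 1)\<^esub> \<one>\<^bsub>grp C (n - 1 - 1)\<^esub> = N (n - 1 - 1)"
    using subgroup.subset[OF subgroup_N] by (rule coset_mult_one)
  then show "bd (quotient_complex C N) (n - 1) (bd (quotient_complex C N) n S) =
      \<one>\<^bsub>grp (quotient_complex C N) (n - 1 - 1)\<^esub>"
    using x by (simp add: bd_coset bd_bd del: quotient_complex_simps(2))
qed

sublocale quot: algebraic_complex "quotient_complex C N"
  by (rule algebraic_complex_quotient)

lemma chain_morphism_quotient_map: "chain_morphism C (quotient_complex C N) (quotient_map C N)"
proof
  fix n
  show "quotient_map C N n \<in> hom (grp C n) (grp (quotient_complex C N) n)"
    by (rule homI)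
      (auto simp: quotient_map_def carrier_FactGroup Mod_mult[OF comm_group_grp subgroup_N])
  fix x assume "x \<in> carrier (grp C n)"
  then show "quotient_map C N (n - 1) (bd C n x) = bd (quotient_complex C N) n (quotient_map C N n x)"
    by (simp add: quotient_map_def bd_coset del: quotient_complex_simps)
qed

lemma quotient_map_surj: "quotient_map C N n ` carrier (grp C n) = carrier (grp (quotient_complex C N) n)"
  by (auto simp: quotient_map_def carrier_FactGroup)

lemma quotient_map_eq_one_iff:
  "x \<in> carrier (grp C n) \<Longrightarrow> quotient_map C N n x = \<one>\<^bsub>grp (quotient_complex C N) n\<^esub> \<longleftrightarrow> x \<in> N n"
  by (simp add: quotient_map_def Mod_eq_one_iff comm_group_grp subgroup_N)

end

lemma (in chain_morphism) subcomplex_image: "subcomplex D (\<lambda>n. f n ` carrier (grp C n))"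
proof (rule subcomplex.intro, fact D.algebraic_complex_axioms, rule subcomplex_axioms.intro)
  fix n
  show "subgroup (f n ` carrier (grp C n)) (grp D n)" by (rule f.img_is_subgroup)
  show "bd D n ` f n ` carrier (grp C n) \<subseteq> f (n - 1) ` carrier (grp C (n - 1))"
    by (auto simp flip: f_bd)
qed

text \<open>Applied to the identity on unnormalized cubical chains and the two degenerate
  subcomplexes, the induced map is \<open>cubical_inclusion\<close>.\<close>

lemma (in chain_morphism) quotient_morphism:
  assumes N: "subcomplex C N" and M: "subcomplex D M" and fN: "\<And>n. f n ` N n \<subseteq> M n"
  shows "chain_morphism (quotient_complex C N) (quotient_complex D M) (\<lambda>n S. M n <#>\<^bsub>grp D n\<^esub> (f n ` S))"
proof -
  interpret N: subcomplex C N by fact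
  interpret M: subcomplex D M by fact
  have coset: "M n <#>\<^bsub>grp D n\<^esub> (f n ` (N n #>\<^bsub>grp C n\<^esub> x)) = M n #>\<^bsub>grp D n\<^esub> f n x"
    if "x \<in> carrier (grp C n)" for n x
    by (rule Mod_map_coset[OF C.comm_group_grp N.subgroup_N D.comm_group_grp M.subgroup_N f_hom fN that])
  show ?thesis
  proof
    fix n
    have "group_hom (grp C n Mod N n) (grp D n Mod M n) (\<lambda>S. M n <#>\<^bsub>grp D n\<^esub> (f n ` S))"
      by (rule Mod_group_hom[where R = "\<lambda>x y. y = f n x"])
        (auto simp: coset C.comm_group_grp D.comm_group_grp N.subgroup_N M.subgroup_N)
    then show "(\<lambda>S. M n <#>\<^bsub>grp D n\<^esub> (f n ` S)) \<in> hom (grp (quotient_complex C N) n) (grp (quotient_complex D M) n)"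
      by (simp add: group_hom_def group_hom_axioms_def)
    fix S assume "S \<in> carrier (grp (quotient_complex C N) n)"
    then obtain x where x: "x \<in> carrier (grp C n)" "S = N n #>\<^bsub>grp C n\<^esub> x"
      by (auto simp: carrier_FactGroup)
    then show "M (n - 1) <#>\<^bsub>grp D (n - 1)\<^esub> f (n - 1) ` bd (quotient_complex C N) n S =
        bd (quotient_complex D M) n (M n <#>\<^bsub>grp D n\<^esub> f n ` S)"
      by (simp add: N.bd_coset M.bd_coset coset f_bd del: quotient_complex_simps)
  qed
qed

lemma (in chain_morphism) quotient_split:
  assumes N: "subcomplex C N" and M: "subcomplex D M" and fN: "f n ` N n \<subseteq> M n"
    and r: "r \<in> hom (grp D n) (grp C n)" and rM: "r ` M n \<subseteq> N n"
    and rf: "\<And>x. x \<in> carrier (grp C n) \<Longrightarrow> r (f n x) = x"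
  shows "\<exists>r \<in> hom (grp (quotient_complex D M) n) (grp (quotient_complex C N) n).
    \<forall>S \<in> carrier (grp (quotient_complex C N) n). r (M n <#>\<^bsub>grp D n\<^esub> (f n ` S)) = S"
proof -
  interpret N: subcomplex C N by fact
  interpret M: subcomplex D M by fact
  have coset: "M n <#>\<^bsub>grp D n\<^esub> (f n ` (N n #>\<^bsub>grp C n\<^esub> x)) = M n #>\<^bsub>grp D n\<^esub> f n x"
    if "x \<in> carrier (grp C n)" for x
    by (rule Mod_map_coset[OF C.comm_group_grp N.subgroup_N D.comm_group_grp M.subgroup_N f_hom fN that])
  have coset': "N n <#>\<^bsub>grp C n\<^esub> (r ` (M n #>\<^bsub>grp D n\<^esub> x)) = N n #>\<^bsub>grp C n\<^esub> r x"
    if "x \<in> carrier (grp D n)" for x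
    by (rule Mod_map_coset[OF D.comm_group_grp M.subgroup_N C.comm_group_grp N.subgroup_N r rM that])
  have "group_hom (grp D n Mod M n) (grp C n Mod N n) (\<lambda>S. N n <#>\<^bsub>grp C n\<^esub> (r ` S))"
    by (rule Mod_group_hom[where R = "\<lambda>x y. y = r x"])
      (use r in \<open>auto simp: coset' C.comm_group_grp D.comm_group_grp N.subgroup_N M.subgroup_N
        hom_in_carrier hom_mult\<close>)
  then have "(\<lambda>S. N n <#>\<^bsub>grp C n\<^esub> (r ` S)) \<in> hom (grp (quotient_complex D M) n) (grp (quotient_complex C N) n)"
    by (simp add: group_hom_def group_hom_axioms_def)
  moreover have "N n <#>\<^bsub>grp C n\<^esub> (r ` (M n <#>\<^bsub>grp D n\<^esub> (f n ` S))) = S"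
    if "S \<in> carrier (grp (quotient_complex C N) n)" for S
    using that by (auto simp: carrier_FactGroup coset coset' rf)
  ultimately show ?thesis by (intro bexI[where x = "\<lambda>S. N n <#>\<^bsub>grp C n\<^esub> (r ` S)"] ballI)
qed

text \<open>Surjectivity of the quotient map makes its pullback injective, and a cochain that is
  trivial on the image of \<open>f\<close> factors through the quotient. The left inverses give the
  last condition: a cochain on \<open>C\<close> extends to \<open>D\<close> by composition with
  \<open>r\<close>.\<close>

lemma (in chain_morphism) cohomology_sequence_exact_if_split:
  fixes G :: "'g monoid"
  assumes G: "comm_group G"
    and split: "\<And>n. \<exists>r \<in> hom (grp D n) (grp C n). \<forall>x \<in> carrier (grp C n). r (f n x) = x"
  shows "cohomology_sequence_exact C f D G"
proof -
  define N where "N = (\<lambda>n. f n ` carrier (grp C n))"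
  define Q where "Q = quotient_complex D N"
  define q where "q = quotient_map D N"
  interpret G: comm_group G by fact
  interpret subcomplex D N unfolding N_def by (rule subcomplex_image)
  interpret Q: algebraic_complex Q unfolding Q_def by (rule algebraic_complex_quotient)
  interpret q: chain_morphism D Q q
    unfolding q_def Q_def by (rule chain_morphism_quotient_map)
  have q_surj: "q n ` carrier (grp D n) = carrier (grp Q n)" for n
    unfolding q_def Q_def by (rule quotient_map_surj)
  have q_eq_one: "q n x = \<one>\<^bsub>grp Q n\<^esub> \<longleftrightarrow> x \<in> f n ` carrier (grp C n)" if "x \<in> carrier (grp D n)" for n x
    using quotient_map_eq_one_iff[OF that] unfolding q_def Q_def N_def .
  interpret cq: cochain_map "cochains Q G" "coboundary Q" "cochains D G" "coboundary D" "pullback D q"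
    by (rule q.cochain_map_pullback) fact
  interpret cf: cochain_map "cochains D G" "coboundary D" "cochains C G" "coboundary C" "pullback C f"
    by (rule cochain_map_pullback) fact
  interpret short_exact_cochains "cochains Q G" "coboundary Q" "cochains D G" "coboundary D"
    "cochains C G" "coboundary C" "pullback D q" "pullback C f"
  proof
    fix n
    show "inj_on (pullback D q n) (carrier (cochains Q G n))"
    proof (rule inj_onI)
      fix \<phi> \<psi> assume *: "\<phi> \<in> carrier (cochains Q G n)" "\<psi> \<in> carrier (cochains Q G n)"
        "pullback D q n \<phi> = pullback D q n \<psi>"
      show "\<phi> = \<psi>"
      proof (rule extensionalityI[of _ "carrier (grp Q n)"])
        fix y assume "y \<in> carrier (grp Q n)"
        then obtain x where "x \<in> carrier (grp D n)" "y = q n x" using q_surj by blast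
        then show "\<phi> y = \<psi> y"
          using fun_cong[OF *(3), of x] by (simp add: pullback_def)
      qed (use * in \<open>simp_all add: carrier_cochains\<close>)
    qed
  next
    fix n \<phi> assume phi: "\<phi> \<in> carrier (cochains D G n)"
    then have hom: "\<phi> \<in> hom (grp D n) G" by (simp add: carrier_cochains)
    interpret phi: group_hom "grp D n" G \<phi> by unfold_locales (rule hom)
    show "pullback C f n \<phi> = \<one>\<^bsub>cochains C G n\<^esub> \<longleftrightarrow> \<phi> \<in> pullback D q n ` carrier (cochains Q G n)"
    proof
      assume "pullback C f n \<phi> = \<one>\<^bsub>cochains C G n\<^esub>"
      then have ker: "\<phi> (f n x) = \<one>\<^bsub>G\<^esub>" if "x \<in> carrier (grp C n)" for x
        using that by (auto simp: pullback_def one_cochains fun_eq_iff restrict_def split: if_splits)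
      \<comment> \<open>Members of one coset differ by some \<open>f n c\<close>, on which
        \<open>\<phi>\<close> is trivial. This constancy is what the universal property of the
        quotient group asks for.\<close>
      have const: "\<phi> x = \<phi> y" if "x \<in> carrier (grp D n)" "y \<in> carrier (grp D n)"
        "N n #>\<^bsub>grp D n\<^esub> x = N n #>\<^bsub>grp D n\<^esub> y" for x y
      proof -
        have "\<exists>b\<in>N n. y = b \<otimes>\<^bsub>grp D n\<^esub> x"
          using that(3) Mod_eq_iff[OF D.comm_group_grp subgroup_N that(1,2)] by simp
        then obtain c where "c \<in> carrier (grp C n)" "y = f n c \<otimes>\<^bsub>grp D n\<^esub> x" by (auto simp: N_def)
        then show ?thesis using that ker by simp
      qed
      obtain \<psi> where psi: "\<psi> \<in> hom (grp D n Mod N n) G"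
        "\<And>x. x \<in> carrier (grp D n) \<Longrightarrow> \<psi> (N n #>\<^bsub>grp D n\<^esub> x) = \<phi> x"
        by (rule FactGroup_universal[OF hom D.subgroup_imp_normal[OF subgroup_N]], erule (2) const) (rule that)
      \<comment> \<open>The universal property fixes \<open>\<psi>\<close> on cosets only; cochains
        must in addition be extensional.\<close>
      define \<psi>' where "\<psi>' = restrict \<psi> (carrier (grp Q n))"
      have "\<psi>' \<in> carrier (cochains Q G n)"
      proof -
        have "\<psi> \<in> hom (grp Q n) G" using psi(1) by (simp add: Q_def)
        then have "\<psi>' \<in> hom (grp Q n) G"
          by (rule Q.hom_restrict) (simp add: \<psi>'_def)
        then show ?thesis by (simp add: carrier_cochains \<psi>'_def)
      qed
      moreover have "pullback D q n \<psi>' = \<phi>"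
      proof (rule extensionalityI[of _ "carrier (grp D n)"])
        show "pullback D q n \<psi>' x = \<phi> x" if "x \<in> carrier (grp D n)" for x
          using that q.f.hom_closed[OF that] psi(2) by (simp add: pullback_def \<psi>'_def) (simp add: q_def quotient_map_def)
      qed (use phi in \<open>simp_all add: carrier_cochains pullback_def\<close>)
      ultimately show "\<phi> \<in> pullback D q n ` carrier (cochains Q G n)" by blast
    next
      assume "\<phi> \<in> pullback D q n ` carrier (cochains Q G n)"
      then obtain \<psi> where psi: "\<psi> \<in> hom (grp Q n) G" "\<phi> = pullback D q n \<psi>"
        by (auto simp: carrier_cochains)
      interpret psi: group_hom "grp Q n" G \<psi> by unfold_locales (rule psi)
      have "q n (f n x) = \<one>\<^bsub>grp Q n\<^esub>" if "x \<in> carrier (grp C n)" for x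
        using that q_eq_one by simp
      then show "pullback C f n \<phi> = \<one>\<^bsub>cochains C G n\<^esub>"
        by (auto simp: pullback_def one_cochains psi(2))
    qed
  next
    fix n
    show "pullback C f n ` carrier (cochains D G n) = carrier (cochains C G n)"
    proof
      show "pullback C f n ` carrier (cochains D G n) \<subseteq> carrier (cochains C G n)" by auto
      show "carrier (cochains C G n) \<subseteq> pullback C f n ` carrier (cochains D G n)"
      proof
        fix \<phi> assume phi: "\<phi> \<in> carrier (cochains C G n)"
        obtain r where r: "r \<in> hom (grp D n) (grp C n)" "\<And>x. x \<in> carrier (grp C n) \<Longrightarrow> r (f n x) = x"
          using split by blast
        \<comment> \<open>The extension of \<open>\<phi>\<close>. It is merely a cochain, not a
          cocycle, even if \<open>\<phi>\<close> is one: \<open>r\<close> ignores the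
          boundary.\<close>
        have "restrict (\<phi> \<circ> r) (carrier (grp D n)) \<in> carrier (cochains D G n)"
          using hom_in_carrier[OF hom_group_precompose[OF D.is_group r(1), where G = G]] phi
          by (simp add: cochains_def)
        moreover have "pullback C f n (restrict (\<phi> \<circ> r) (carrier (grp D n))) = \<phi>"
          using phi r(2) by (auto simp: pullback_def carrier_cochains extensional_def)
        ultimately show "\<phi> \<in> pullback C f n ` carrier (cochains D G n)" by (metis imageI)
      qed
    qed
  qed
  \<comment> \<open>The groups and maps of the statement are, by unfolding, those of the abstract
    development.\<close>
  have co: "cohomology Q G = (\<lambda>n. cq.K.ZK n Mod cq.K.B n)"
    "cohomology D G = (\<lambda>n. cq.L.ZK n Mod cq.L.B n)"
    "cohomology C G = (\<lambda>n. cf.L.ZK n Mod cf.L.B n)"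
    by (simp_all add: fun_eq_iff cohomology_def cocycles_def coboundaries_def
        cq.K.ZK_def cq.K.Z_def cq.K.B_def cq.L.ZK_def cq.L.Z_def cq.L.B_def
        cf.L.ZK_def cf.L.Z_def cf.L.B_def)
  have maps: "cohomology_map D q G = cq.H_map" "cohomology_map C f G = cf.H_map"
    "connecting_map C f D q Q G = delta"
    by (simp_all add: fun_eq_iff cohomology_map_def cq.H_map_def cf.H_map_def coboundaries_def
        cq.L.B_def cf.L.B_def connecting_map_def delta_def)
  have "long_exact_sequence (cohomology Q G) (cohomology_map D q G) (cohomology D G)
    (cohomology_map C f G) (cohomology C G) (connecting_map C f D q Q G)"
    unfolding long_exact_sequence_def co maps using exact_K exact_L exact_P by blast
  then show ?thesis
    unfolding cohomology_sequence_exact_def Let_def N_def Q_def q_def .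
qed

section \<open>Free Abelian chain complexes\<close>

lemma frag_extend_hom:
  assumes "\<And>x. x \<in> S \<Longrightarrow> Poly_Mapping.keys (f x) \<subseteq> S'"
  shows "frag_extend f \<in> hom (free_Abelian_group S) (free_Abelian_group S')"
proof (rule homI)
  fix c assume "c \<in> carrier (free_Abelian_group S)"
  then show "frag_extend f c \<in> carrier (free_Abelian_group S')"
    using keys_frag_extend[of f c] assms by fastforce
qed (simp add: frag_extend_add)

lemma frag_extend_frag_extend: "frag_extend f (frag_extend g c) = frag_extend (\<lambda>x. frag_extend f (g x)) c"
  by (rule frag_induction[OF subset_UNIV]) (simp_all add: frag_extend_diff)

lemma frag_extend_sum_cmul:
  "frag_extend (\<lambda>x. \<Sum>i\<in>I. frag_cmul (k i) (f i x)) c = (\<Sum>i\<in>I. frag_cmul (k i) (frag_extend (f i) c))"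
  unfolding frag_extend_def frag_cmul_sum
  by (subst sum.swap) (simp add: mult.commute)

text \<open>The classical cancellation behind a vanishing squared boundary: the index pair
  \<open>(i, j)\<close> with \<open>i \<le> j\<close> is matched with \<open>(j + 1, i)\<close>,
  where \<open>g\<close> has the same value and the sign is opposite. The inverse matching is
  \<open>(i, j)\<close> to \<open>(j, i - 1)\<close>.\<close>

lemma alternating_double_sum_eq_0:
  fixes g :: "nat \<Rightarrow> nat \<Rightarrow> 'a \<Rightarrow>\<^sub>0 int"
  assumes g: "\<And>i j. i \<le> j \<Longrightarrow> j < m \<Longrightarrow> g (Suc j) i = g i j"
  shows "(\<Sum>i<Suc m. \<Sum>j<m. frag_cmul ((-1) ^ (i + j)) (g i j)) = 0"
proof -
  define h where "h = (\<lambda>(i, j). frag_cmul ((-1) ^ (i + j)) (g i j))"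
  define U where "U = {(i, j). i < Suc m \<and> j < m \<and> i \<le> j}"
  define L where "L = {(i, j). i < Suc m \<and> j < m \<and> j < i}"
  have UL: "{..<Suc m} \<times> {..<m} = U \<union> L" "U \<inter> L = {}" by (auto simp: U_def L_def)
  have "finite (U \<union> L)" by (simp flip: UL(1))
  then have fin: "finite U" "finite L" by simp_all
  have "(\<Sum>p\<in>U. - h p) = sum h L"
    by (rule sum.reindex_bij_witness[of _ "\<lambda>(i, j). (j, i - 1)" "\<lambda>(i, j). (Suc j, i)"])
      (auto simp: U_def L_def h_def g add.commute)
  then have "sum h L = - sum h U" by (simp add: sum_negf)
  then have "sum h U + sum h L = 0" by simp
  then have "sum h ({..<Suc m} \<times> {..<m}) = 0"
    unfolding UL(1) using fin UL(2) by (simp add: sum.union_disjoint)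
  then show ?thesis
    by (simp add: sum.cartesian_product h_def)
qed

text \<open>Common core for simplices and cubes: \<open>d i\<close> is the \<open>i\<close>-th face
  of a generator as a chain, \<open>d' j\<close> the \<open>j\<close>-th face operator one degree
  lower. For cubes a face means the difference of two opposite faces.\<close>

lemma alternating_boundary_square:
  assumes d: "\<And>i j. i \<le> j \<Longrightarrow> j < m \<Longrightarrow> frag_extend (d' i) (d (Suc j)) = frag_extend (d' j) (d i)"
  shows "frag_extend (\<lambda>y. \<Sum>j<m. frag_cmul ((-1) ^ j) (d' j y)) (\<Sum>i<Suc m. frag_cmul ((-1) ^ i) (d i)) = 0"
proof -
  have "(\<Sum>i<Suc m. \<Sum>j<m. frag_cmul ((-1) ^ (i + j)) (frag_extend (d' j) (d i))) = 0"
    by (rule alternating_double_sum_eq_0) (simp add: d)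
  then have "(\<Sum>j<m. \<Sum>i<Suc m. frag_cmul ((-1) ^ (j + i)) (frag_extend (d' j) (d i))) = 0"
    by (subst sum.swap) (simp only: add.commute)
  then show ?thesis
    by (simp only: frag_extend_sum[OF finite_lessThan] comp_def frag_extend_cmul frag_extend_sum_cmul
        frag_cmul_sum frag_cmul_cmul power_add)
qed

text \<open>By additivity of \<open>frag_extend\<close>, well-definedness and the vanishing square
  need only be checked on generators.\<close>

lemma algebraic_complex_free:
  assumes grp: "\<And>n. grp C n = free_Abelian_group (S n)" and bd: "\<And>n. bd C n = frag_extend (b n)"
    and keys: "\<And>n x. x \<in> S n \<Longrightarrow> Poly_Mapping.keys (b n x) \<subseteq> S (n - 1)"
    and bb: "\<And>n x. x \<in> S n \<Longrightarrow> frag_extend (b (n - 1)) (b n x) = 0"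
  shows "algebraic_complex C"
proof (rule algebraic_complex.intro)
  fix n
  show "comm_group (grp C n)" unfolding grp by (rule abelian_free_Abelian_group)
  show "bd C n \<in> hom (grp C n) (grp C (n - 1))"
    unfolding grp bd using keys by (rule frag_extend_hom)
  fix c assume "c \<in> carrier (grp C n)"
  then have c: "Poly_Mapping.keys c \<subseteq> S n" by (simp add: grp)
  show "bd C (n - 1) (bd C n c) = \<one>\<^bsub>grp C (n - 1 - 1)\<^esub>"
    unfolding grp bd frag_extend_frag_extend one_free_Abelian_group
    by (rule frag_extend_eq_0) (use bb c in auto)
qed

text \<open>The retraction onto the chains with support in \<open>S\<close>.\<close>

definition frag_restrict :: "'x set \<Rightarrow> ('x \<Rightarrow>\<^sub>0 int) \<Rightarrow> ('x \<Rightarrow>\<^sub>0 int)" where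
  "frag_restrict S = frag_extend (\<lambda>x. if x \<in> S then frag_of x else 0)"

lemma frag_restrict_hom: "frag_restrict S \<in> hom (free_Abelian_group S') (free_Abelian_group S)"
  unfolding frag_restrict_def by (rule frag_extend_hom) auto

lemma frag_restrict_id: "Poly_Mapping.keys c \<subseteq> S \<Longrightarrow> frag_restrict S c = c"
proof -
  assume "Poly_Mapping.keys c \<subseteq> S"
  then have "frag_restrict S c = frag_extend frag_of c"
    unfolding frag_restrict_def by (intro frag_extend_eq) auto
  then show ?thesis by (simp flip: frag_expansion)
qed

lemma keys_frag_restrict: "Poly_Mapping.keys (frag_restrict S c) \<subseteq> Poly_Mapping.keys c \<inter> S"
  using keys_frag_extend[of "\<lambda>x. if x \<in> S then frag_of x else 0" c]
  by (auto simp: frag_restrict_def split: if_splits)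

text \<open>Turns the generated subgroup of degenerate chains into a condition on supports, which
  the boundary and the retraction can be tested against directly.\<close>

lemma generate_free_Abelian_group:
  assumes "D \<subseteq> S"
  shows "generate (free_Abelian_group S) (frag_of ` D) = {c. Poly_Mapping.keys c \<subseteq> D}"
proof -
  interpret comm_group "free_Abelian_group S" by (rule abelian_free_Abelian_group)
  let ?g = "generate (free_Abelian_group S) (frag_of ` D)"
  have D: "frag_of ` D \<subseteq> carrier (free_Abelian_group S)" using assms by auto
  interpret g: subgroup ?g "free_Abelian_group S" by (rule generate_is_subgroup[OF D])
  have "subgroup {c. Poly_Mapping.keys c \<subseteq> D} (free_Abelian_group S)"
  proof
    fix a b :: "'a \<Rightarrow>\<^sub>0 int" assume "a \<in> {c. Poly_Mapping.keys c \<subseteq> D}" "b \<in> {c. Poly_Mapping.keys c \<subseteq> D}"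
    then show "a \<otimes>\<^bsub>free_Abelian_group S\<^esub> b \<in> {c. Poly_Mapping.keys c \<subseteq> D}"
      using keys_add[of a b] by auto
  next
    fix a :: "'a \<Rightarrow>\<^sub>0 int" assume "a \<in> {c. Poly_Mapping.keys c \<subseteq> D}"
    then show "inv\<^bsub>free_Abelian_group S\<^esub> a \<in> {c. Poly_Mapping.keys c \<subseteq> D}"
      using assms inv_free_Abelian_group[of a S] by auto
  qed (use assms in auto)
  then have "?g \<subseteq> {c. Poly_Mapping.keys c \<subseteq> D}"
    by (rule generate_subgroup_incl[rotated]) auto
  moreover have "c \<in> ?g" if "Poly_Mapping.keys c \<subseteq> D" for c
    using that
  proof (induction rule: frag_induction)
    case zero
    show ?case using g.one_closed by simp
  next
    case (one x)
    then show ?case by (intro generate.incl) auto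
  next
    case (diff a b)
    moreover have "Poly_Mapping.keys b \<subseteq> S" using subsetD[OF g.subset diff(2)] by simp
    ultimately show ?case
      using g.m_closed[OF diff(1) g.m_inv_closed[OF diff(2)]] by simp
  qed
  ultimately show ?thesis by blast
qed

section \<open>Continuous maps of closure spaces\<close>

lemma
  assumes "closure_space X"
  shows cl_empty: "cl X {} = {}"
    and cl_increasing: "A \<subseteq> points X \<Longrightarrow> A \<subseteq> cl X A"
    and cl_subset_points: "A \<subseteq> points X \<Longrightarrow> cl X A \<subseteq> points X"
    and cl_Un: "A \<subseteq> points X \<Longrightarrow> B \<subseteq> points X \<Longrightarrow> cl X (A \<union> B) = cl X A \<union> cl X B"
  using assms by (simp_all add: closure_space_def)

lemma closure_space_topological: "closure_space (topological_clspace T)"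
  unfolding closure_space_def topological_clspace_def clspace.select_convs
  by (intro conjI allI impI closure_of_empty closure_of_subset closure_of_subset_topspace closure_of_Un)

lemma closure_space_indiscrete: "closure_space (indiscrete_clspace S)"
  by (auto simp: closure_space_def indiscrete_clspace_def)

lemma closure_space_upward: "closure_space (upward_clspace S)"
  by (auto simp: closure_space_def upward_clspace_def)

lemma closure_space_relabel:
  assumes X: "closure_space X" and h: "inj_on h (points X)"
  shows "closure_space (relabel h X)"
proof -
  have sub: "{x \<in> points X. h x \<in> B} \<subseteq> points X" for B by blast
  have "{x \<in> points X. h x \<in> A \<union> B} = {x \<in> points X. h x \<in> A} \<union> {x \<in> points X. h x \<in> B}" for A B
    by blast
  then have "cl X {x \<in> points X. h x \<in> A \<union> B} = cl X {x \<in> points X. h x \<in> A} \<union> cl X {x \<in> points X. h x \<in> B}"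
    for A B
    using cl_Un[OF X sub sub] by simp
  moreover have "A \<subseteq> h ` cl X {x \<in> points X. h x \<in> A}" if "A \<subseteq> h ` points X" for A
  proof -
    have "A \<subseteq> h ` {x \<in> points X. h x \<in> A}" using that by blast
    also have "\<dots> \<subseteq> h ` cl X {x \<in> points X. h x \<in> A}"
      using cl_increasing[OF X sub] by (rule image_mono)
    finally show ?thesis .
  qed
  moreover have "cl X {x \<in> points X. h x \<in> A} \<subseteq> points X" for A
    using cl_subset_points[OF X sub] .
  ultimately show ?thesis
    by (simp add: closure_space_def relabel_def image_Un image_mono cl_empty[OF X])
qed

text \<open>Serves to pass to the extensional version of a continuous map. The closure axioms on
  \<open>X\<close> keep closures inside \<open>points X\<close>, where the two functions
  agree.\<close>

lemma cl_continuous_cong: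
  assumes "closure_space X" "cl_continuous X Y f" "\<And>x. x \<in> points X \<Longrightarrow> f x = g x"
  shows "cl_continuous X Y g"
  unfolding cl_continuous_def
proof (intro conjI allI impI)
  show "g \<in> points X \<rightarrow> points Y"
    using assms(2,3) by (auto simp: cl_continuous_def Pi_iff)
  fix A assume A: "A \<subseteq> points X"
  then have "cl X A \<subseteq> points X" by (rule cl_subset_points[OF assms(1)])
  then have "g ` cl X A = f ` cl X A" "g ` A = f ` A" using A assms(3) by (auto intro!: image_cong)
  then show "g ` cl X A \<subseteq> cl Y (g ` A)" using A assms(2) by (simp add: cl_continuous_def)
qed

lemma cl_continuous_compose:
  assumes f: "cl_continuous X Y f" and g: "cl_continuous Y Z g"
  shows "cl_continuous X Z (g \<circ> f)"
  unfolding cl_continuous_def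
proof (intro conjI allI impI)
  show "g \<circ> f \<in> points X \<rightarrow> points Z" using f g by (auto simp: cl_continuous_def)
  fix A assume A: "A \<subseteq> points X"
  then have "f ` A \<subseteq> points Y" using f by (auto simp: cl_continuous_def)
  then have "g ` cl Y (f ` A) \<subseteq> cl Z (g ` f ` A)" using g by (simp add: cl_continuous_def)
  moreover have "f ` cl X A \<subseteq> cl Y (f ` A)" using f A by (simp add: cl_continuous_def)
  ultimately show "(g \<circ> f) ` cl X A \<subseteq> cl Z ((g \<circ> f) ` A)" unfolding image_comp[symmetric] by blast
qed

text \<open>Pulling the image of \<open>B\<close> back along \<open>k\<close> gives a set that
  contains the image under \<open>f\<close> of the pulled back \<open>B\<close>; monotonicity of the
  closure of \<open>Y\<close> absorbs the difference.\<close>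

lemma cl_continuous_relabel:
  assumes Y: "closure_space Y" and f: "cl_continuous X Y f"
    and comm: "\<And>x. x \<in> points X \<Longrightarrow> f' (h x) = k (f x)"
    and X: "closure_space X"
  shows "cl_continuous (relabel h X) (relabel k Y) f'"
  unfolding cl_continuous_def
proof (intro conjI allI impI)
  show "f' \<in> points (relabel h X) \<rightarrow> points (relabel k Y)"
    using f comm by (auto simp: cl_continuous_def relabel_def Pi_iff)
  fix B
  let ?B = "{x \<in> points X. h x \<in> B}"
  have sub: "cl X ?B \<subseteq> points X" by (rule cl_subset_points[OF X]) blast
  have "f ` ?B \<subseteq> {y \<in> points Y. k y \<in> f' ` B}"
  proof
    fix y assume "y \<in> f ` ?B"
    then obtain x where x: "x \<in> points X" "h x \<in> B" "y = f x" by blast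
    then have "k y = f' (h x)" "y \<in> points Y" using f comm by (auto simp: cl_continuous_def)
    then show "y \<in> {y \<in> points Y. k y \<in> f' ` B}" using x by simp
  qed
  then have "cl Y (f ` ?B) \<subseteq> cl Y {y \<in> points Y. k y \<in> f' ` B}"
    by (rule closure_space_mono[OF Y]) auto
  moreover have "f ` cl X ?B \<subseteq> cl Y (f ` ?B)"
    using f by (simp add: cl_continuous_def)
  ultimately have "k ` f ` cl X ?B \<subseteq> k ` cl Y {y \<in> points Y. k y \<in> f' ` B}"
    by (intro image_mono) (rule order_trans)
  moreover have "f' ` h ` cl X ?B = k ` f ` cl X ?B"
    unfolding image_image using sub comm by (intro image_cong) auto
  ultimately show "f' ` cl (relabel h X) B \<subseteq> cl (relabel k Y) (f' ` B)"
    by (simp add: relabel_def)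
qed

lemma cl_continuous_topological:
  assumes "continuous_map T T' f"
  shows "cl_continuous (topological_clspace T) (topological_clspace T') f"
  using assms continuous_map_image_closure_subset[OF assms]
  by (auto simp: cl_continuous_def topological_clspace_def continuous_map_def)

lemma cl_continuous_into_indiscrete:
  assumes "f \<in> S \<rightarrow> S'"
  shows "cl_continuous (indiscrete_clspace S) (indiscrete_clspace S') f"
  using assms by (auto simp: cl_continuous_def indiscrete_clspace_def)

lemma cl_continuous_upward:
  assumes "f \<in> S \<rightarrow> S'" "mono_on S f"
  shows "cl_continuous (upward_clspace S) (upward_clspace S') f"
  using assms by (auto simp: cl_continuous_def upward_clspace_def) (meson mono_onD subsetD)

lemma cl_continuous_from_subspace:
  "cl_continuous Y (cl_subspace X A) f \<Longrightarrow> A \<subseteq> points X \<Longrightarrow> cl_continuous Y X f"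
  by (auto simp: cl_continuous_def cl_subspace_def)

text \<open>If \<open>x\<close> were in the closure of the complement of the preimage, continuity
  would put \<open>f x\<close> in the closure of the complement of \<open>V\<close>.\<close>

lemma neighborhood_vimage:
  assumes X: "closure_space X" and Y: "closure_space Y" and f: "cl_continuous X Y f"
    and x: "x \<in> points X" and V: "neighborhood Y (f x) V"
  shows "neighborhood X x {u \<in> points X. f u \<in> V}"
proof -
  let ?W = "points X - {u \<in> points X. f u \<in> V}"
  have "x \<notin> cl X ?W"
  proof
    assume "x \<in> cl X ?W"
    moreover have "f ` cl X ?W \<subseteq> cl Y (f ` ?W)" using f by (simp add: cl_continuous_def)
    ultimately have "f x \<in> cl Y (f ` ?W)" by blast
    moreover have "f ` ?W \<subseteq> points Y - V" using f by (auto simp: cl_continuous_def)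
    ultimately have "f x \<in> cl Y (points Y - V)"
      using closure_space_mono[OF Y, of "f ` ?W" "points Y - V"] by blast
    then show False using V by (simp add: neighborhood_def cl_interior_def)
  qed
  then show ?thesis using x by (simp add: neighborhood_def cl_interior_def)
qed

lemma neighborhood_meets:
  assumes X: "closure_space X" and x: "x \<in> cl X S" and S: "S \<subseteq> points X" and V: "neighborhood X x V"
  shows "V \<inter> S \<noteq> {}"
proof
  assume "V \<inter> S = {}"
  then have "S \<subseteq> points X - V" using S by blast
  then have "cl X S \<subseteq> cl X (points X - V)" by (rule closure_space_mono[OF X]) blast
  then show False using x V by (auto simp: neighborhood_def cl_interior_def)
qed

section \<open>The two products of closure spaces\<close>

lemma points_tensor_space [simp]: "points (tensor_space T X Y) = points X \<times> points Y"
  by (cases T) (simp_all add: cl_product_def cl_inductive_product_def clspace_of_bases_def)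

lemma closure_space_tensor_space:
  "closure_space X \<Longrightarrow> closure_space Y \<Longrightarrow> closure_space (tensor_space T X Y)"
  by (cases T) (simp_all add: closure_space_cl_product closure_space_cl_inductive_product)

text \<open>One criterion for both products, with the case distinction confined to the shape of the
  basic neighborhood, lets each continuity proof run once.\<close>

lemma mem_cl_tensor_space:
  "(x, y) \<in> cl (tensor_space T X Y) S \<longleftrightarrow> x \<in> points X \<and> y \<in> points Y \<and>
    (\<forall>U V. neighborhood X x U \<longrightarrow> neighborhood Y y V \<longrightarrow>
      (case T of Product \<Rightarrow> U \<times> V | Inductive_product \<Rightarrow> {x} \<times> V \<union> U \<times> {y}) \<inter> S \<noteq> {})"
proof (cases T)
  case Product
  then show ?thesis
    by (simp add: cl_product_def clspace_of_bases_def) blast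
next
  case Inductive_product
  then show ?thesis
    by (simp add: cl_inductive_product_def clspace_of_bases_def) blast
qed

text \<open>Replacing \<open>V\<close> by its preimage under \<open>f\<close> gives a basic
  neighborhood of \<open>(y, x)\<close> that is mapped into the given one of
  \<open>(y, f x)\<close>. For the inductive product the arm \<open>U \<times> {x}\<close> goes to
  \<open>U \<times> {f x}\<close>.\<close>

lemma cl_continuous_tensor_right:
  assumes X: "closure_space X" and X': "closure_space X'" and f: "cl_continuous X X' f"
  shows "cl_continuous (tensor_space T Y X) (tensor_space T Y X') (\<lambda>(y, x). (y, f x))"
  unfolding cl_continuous_def
proof (intro conjI allI impI)
  have fX: "f x \<in> points X'" if "x \<in> points X" for x
    using f that by (auto simp: cl_continuous_def)
  then show "(\<lambda>(y, x). (y, f x)) \<in> points (tensor_space T Y X) \<rightarrow> points (tensor_space T Y X')"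
    by auto
  fix S assume S: "S \<subseteq> points (tensor_space T Y X)"
  show "(\<lambda>(y, x). (y, f x)) ` cl (tensor_space T Y X) S \<subseteq> cl (tensor_space T Y X') ((\<lambda>(y, x). (y, f x)) ` S)"
  proof
    fix q assume "q \<in> (\<lambda>(y, x). (y, f x)) ` cl (tensor_space T Y X) S"
    then obtain y x where q: "q = (y, f x)" and yx: "(y, x) \<in> cl (tensor_space T Y X) S"
      by auto
    then have x: "x \<in> points X" and y: "y \<in> points Y" by (simp_all add: mem_cl_tensor_space)
    have "(case T of Product \<Rightarrow> U \<times> V | Inductive_product \<Rightarrow> {y} \<times> V \<union> U \<times> {f x}) \<inter>
        (\<lambda>(y, x). (y, f x)) ` S \<noteq> {}"
      if U: "neighborhood Y y U" and V: "neighborhood X' (f x) V" for U V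
    proof -
      have "neighborhood X x {u \<in> points X. f u \<in> V}"
        by (rule neighborhood_vimage[OF X X' f x V])
      then have "(case T of Product \<Rightarrow> U \<times> {u \<in> points X. f u \<in> V}
          | Inductive_product \<Rightarrow> {y} \<times> {u \<in> points X. f u \<in> V} \<union> U \<times> {x}) \<inter> S \<noteq> {}"
        using yx U unfolding mem_cl_tensor_space by blast
      then obtain b a where "(b, a) \<in> S" "(b, a) \<in> (case T of Product \<Rightarrow> U \<times> {u \<in> points X. f u \<in> V}
          | Inductive_product \<Rightarrow> {y} \<times> {u \<in> points X. f u \<in> V} \<union> U \<times> {x})" by auto
      then have "(b, f a) \<in> (\<lambda>(y, x). (y, f x)) ` S"
        "(b, f a) \<in> (case T of Product \<Rightarrow> U \<times> V | Inductive_product \<Rightarrow> {y} \<times> V \<union> U \<times> {f x})"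
        by (force, auto split: tensor.splits)
      then show ?thesis by blast
    qed
    then show "q \<in> cl (tensor_space T Y X') ((\<lambda>(y, x). (y, f x)) ` S)"
      using fX[OF x] y by (simp add: q mem_cl_tensor_space)
  qed
qed

text \<open>In both products a basic neighborhood of \<open>(e, x)\<close> contains the slice
  \<open>{e} \<times> V\<close>, because \<open>e\<close> lies in \<open>U\<close>.\<close>

lemma cl_continuous_tensor_const:
  assumes X: "closure_space X" and Y: "closure_space Y" and e: "e \<in> points Y"
  shows "cl_continuous X (tensor_space T Y X) (\<lambda>x. (e, x))"
  unfolding cl_continuous_def
proof (intro conjI allI impI)
  show "(\<lambda>x. (e, x)) \<in> points X \<rightarrow> points (tensor_space T Y X)" using e by auto
  fix S assume S: "S \<subseteq> points X"
  show "(\<lambda>x. (e, x)) ` cl X S \<subseteq> cl (tensor_space T Y X) ((\<lambda>x. (e, x)) ` S)"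
  proof
    fix q assume "q \<in> (\<lambda>x. (e, x)) ` cl X S"
    then obtain x where q: "q = (e, x)" and x: "x \<in> cl X S" by blast
    have "(case T of Product \<Rightarrow> U \<times> V | Inductive_product \<Rightarrow> {e} \<times> V \<union> U \<times> {x}) \<inter> (\<lambda>x. (e, x)) ` S \<noteq> {}"
      if U: "neighborhood Y e U" and V: "neighborhood X x V" for U V
    proof -
      obtain s where "s \<in> V" "s \<in> S" using neighborhood_meets[OF X x S V] by blast
      then have "(e, s) \<in> (case T of Product \<Rightarrow> U \<times> V | Inductive_product \<Rightarrow> {e} \<times> V \<union> U \<times> {x})"
        "(e, s) \<in> (\<lambda>x. (e, x)) ` S"
        using neighborhood_mem[OF Y U] by (auto split: tensor.splits)
      then show ?thesis by blast
    qed
    then show "q \<in> cl (tensor_space T Y X) ((\<lambda>x. (e, x)) ` S)"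
      using e subsetD[OF cl_subset_points[OF X S] x] by (simp add: q mem_cl_tensor_space)
  qed
qed

lemma cl_continuous_into_relabel:
  assumes Y: "closure_space Y" and f: "cl_continuous X Y f"
  shows "cl_continuous X (relabel k Y) (k \<circ> f)"
  unfolding cl_continuous_def
proof (intro conjI allI impI)
  have fX: "f ` points X \<subseteq> points Y" using f by (auto simp: cl_continuous_def)
  then show "k \<circ> f \<in> points X \<rightarrow> points (relabel k Y)" by (auto simp: relabel_def)
  fix A assume A: "A \<subseteq> points X"
  have "f ` A \<subseteq> {y \<in> points Y. k y \<in> (k \<circ> f) ` A}" using fX A by auto
  then have "cl Y (f ` A) \<subseteq> cl Y {y \<in> points Y. k y \<in> (k \<circ> f) ` A}"
    by (rule closure_space_mono[OF Y]) auto
  moreover have "f ` cl X A \<subseteq> cl Y (f ` A)" using f A by (simp add: cl_continuous_def)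
  ultimately have "k ` f ` cl X A \<subseteq> k ` cl Y {y \<in> points Y. k y \<in> (k \<circ> f) ` A}"
    by (intro image_mono) (rule order_trans)
  then show "(k \<circ> f) ` cl X A \<subseteq> cl (relabel k Y) ((k \<circ> f) ` A)"
    by (simp add: relabel_def image_image)
qed

section \<open>Singular simplices\<close>

lemma closure_space_simplex: "closure_space (simplex J n)"
  by (cases J) (auto intro!: closure_space_topological closure_space_relabel closure_space_indiscrete
      closure_space_upward inj_on_subset[OF inj_simplex_vertex])

lemma continuous_map_simplical_face:
  assumes "k \<le> Suc m"
  shows "continuous_map (subtopology (powertop_real UNIV) (standard_simplex m))
    (subtopology (powertop_real UNIV) (standard_simplex (Suc m))) (simplical_face k)"
proof -
  have "continuous_map (subtopology (powertop_real UNIV) (standard_simplex m)) euclideanreal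
      (\<lambda>x. simplical_face k x i)" for i
  proof -
    have "continuous_map (powertop_real UNIV) euclideanreal
        (\<lambda>x. if i < k then x i else if i = k then 0 else x (i - 1))"
      by (auto intro: continuous_map_product_projection)
    then show ?thesis by (simp add: simplical_face_def continuous_map_from_subtopology)
  qed
  then show ?thesis
    using simplical_face_in_standard_simplex[of "Suc m" k] assms
    by (auto simp: continuous_map_in_subtopology continuous_map_componentwise)
qed

text \<open>On the finite simplices the face inclusion is induced by the index map that skips
  \<open>k\<close>; its monotonicity is what \<open>Interval_Jplus\<close> requires.\<close>

lemma cl_continuous_simplical_face:
  assumes "k \<le> Suc m"
  shows "cl_continuous (simplex J m) (simplex J (Suc m)) (simplical_face k)"
proof (cases J)
  case Interval_I
  then show ?thesis
    using continuous_map_simplical_face[OF assms] by (simp add: cl_continuous_topological)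
next
  case Interval_J1
  then show ?thesis
    unfolding Interval_J1 simplex.simps
    by (intro cl_continuous_relabel[where f = "\<lambda>i. if i < k then i else i + 1"]
        closure_space_indiscrete cl_continuous_into_indiscrete simplical_face_simplex_vertex) auto
next
  case Interval_Jplus
  then show ?thesis
    unfolding Interval_Jplus simplex.simps
    by (intro cl_continuous_relabel[where f = "\<lambda>i. if i < k then i else i + 1"]
        closure_space_upward cl_continuous_upward simplical_face_simplex_vertex mono_onI) auto
qed

lemma singular_simplices_face:
  assumes "\<sigma> \<in> singular_simplices J X (int (Suc m))" "i \<le> Suc m"
  shows "cl_simplex_face J (Suc m) i \<sigma> \<in> singular_simplices J X (int m)"
proof -
  have "cl_continuous (simplex J m) X (\<sigma> \<circ> simplical_face i)"
    using assms by (intro cl_continuous_compose[OF cl_continuous_simplical_face])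
      (auto simp: singular_simplices_def nat_add_distrib)
  then have "cl_continuous (simplex J m) X (restrict (\<sigma> \<circ> simplical_face i) (points (simplex J m)))"
    by (rule cl_continuous_cong[OF closure_space_simplex]) simp
  then show ?thesis
    by (simp add: singular_simplices_def cl_simplex_face_def)
qed

lemma simplical_face_simplical_face:
  "i \<le> j \<Longrightarrow> simplical_face (Suc j) (simplical_face i t) = simplical_face i (simplical_face j t)"
  by (rule ext) (auto simp: simplical_face_def)

lemma cl_simplex_face_face:
  assumes "i \<le> j" "j \<le> Suc m"
  shows "cl_simplex_face J (Suc m) i (cl_simplex_face J (Suc (Suc m)) (Suc j) \<sigma>) =
    cl_simplex_face J (Suc m) j (cl_simplex_face J (Suc (Suc m)) i \<sigma>)"
proof -
  \<comment> \<open>Ensures that the inner face is evaluated at a point of its domain, so that the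
    intermediate restriction does not interfere with the cosimplicial identity.\<close>
  have "simplical_face k t \<in> points (simplex J (Suc m))" if "t \<in> points (simplex J m)" "k \<le> Suc m" for k t
    using cl_continuous_simplical_face[OF that(2), of J] that(1) by (auto simp: cl_continuous_def)
  then show ?thesis
    using assms by (auto simp: cl_simplex_face_def fun_eq_iff simplical_face_simplical_face restrict_def)
qed

text \<open>The boundary of a single simplex with an integer degree. The value 0 in degrees up to 0
  covers both the special case of \<open>simplex_boundary\<close> and the negative degrees, which
  \<open>nat\<close> sends to 0.\<close>

definition simplex_bd_gen :: "interval \<Rightarrow> int \<Rightarrow> ((nat \<Rightarrow> real) \<Rightarrow> 'a) \<Rightarrow> 'a chain" where
  "simplex_bd_gen J n \<sigma> = (if n \<le> 0 then 0
     else \<Sum>i<Suc (nat n). frag_cmul ((-1) ^ i) (frag_of (cl_simplex_face J (nat n) i \<sigma>)))"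

lemma algebraic_complex_simplicial:
  fixes X :: "'a clspace"
  shows "algebraic_complex (simplicial_chains J X)"
proof (rule algebraic_complex_free)
  fix n
  show "grp (simplicial_chains J X) n = free_Abelian_group (singular_simplices J X n)"
    by (simp add: simplicial_chains_def)
  show "bd (simplicial_chains J X) n = frag_extend (simplex_bd_gen J n)"
  proof (cases "n \<le> 0")
    case True
    have "frag_extend (simplex_bd_gen J n) c = 0" for c :: "'a chain"
      using True by (intro frag_extend_eq_0) (simp add: simplex_bd_gen_def)
    then have "frag_extend (simplex_bd_gen J n) = (\<lambda>_ :: 'a chain. 0)" by (rule ext)
    moreover have "bd (simplicial_chains J X) n = (\<lambda>_. 0)"
      using True by (simp add: simplicial_chains_def simplex_boundary_def)
    ultimately show ?thesis by simp
  next
    case False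
    then show ?thesis
      by (simp add: simplicial_chains_def simplex_boundary_def simplex_bd_gen_def[abs_def]
          atLeast0AtMost lessThan_Suc_atMost)
  qed
  fix \<sigma> assume s: "\<sigma> \<in> singular_simplices J X n"
  show "Poly_Mapping.keys (simplex_bd_gen J n \<sigma>) \<subseteq> singular_simplices J X (n - 1)"
  proof (cases "n \<le> 0")
    case False
    then obtain m where n: "n = int (Suc m)" using that[of "nat (n - 1)"] by simp
    have "frag_cmul ((-1) ^ i) (frag_of (cl_simplex_face J (Suc m) i \<sigma>)) \<in>
        carrier (free_Abelian_group (singular_simplices J X (n - 1)))" if "i \<in> {..<Suc (Suc m)}" for i
    proof -
      have "cl_simplex_face J (Suc m) i \<sigma> \<in> singular_simplices J X (int m)"
        using s that unfolding n by (intro singular_simplices_face) auto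
      moreover have "n - 1 = int m" by (simp add: n)
      ultimately show ?thesis by auto
    qed
    then have "(\<Sum>i<Suc (Suc m). frag_cmul ((-1) ^ i) (frag_of (cl_simplex_face J (Suc m) i \<sigma>))) \<in>
        carrier (free_Abelian_group (singular_simplices J X (n - 1)))"
      by (rule sum_closed_free_Abelian_group)
    then show ?thesis by (simp add: simplex_bd_gen_def n nat_add_distrib)
  qed (simp add: simplex_bd_gen_def)
  show "frag_extend (simplex_bd_gen J (n - 1)) (simplex_bd_gen J n \<sigma>) = 0"
  proof (cases "n \<le> 1")
    case True
    then show ?thesis by (intro frag_extend_eq_0) (simp add: simplex_bd_gen_def)
  next
    case False
    then obtain m where n: "n = int (Suc (Suc m))"
      using that[of "nat (n - 2)"] by simp
    have bd: "simplex_bd_gen J (int (Suc k)) =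
        (\<lambda>\<sigma>. \<Sum>i<Suc (Suc k). frag_cmul ((-1) ^ i) (frag_of (cl_simplex_face J (Suc k) i \<sigma>)))" for k
      by (rule ext) (simp only: simplex_bd_gen_def nat_int of_nat_le_0_iff nat.distinct if_False)
    have "n - 1 = int (Suc m)" by (simp add: n)
    then show ?thesis
      unfolding n bd
      by (simp only: bd) (rule alternating_boundary_square, simp add: cl_simplex_face_face)
  qed
qed

lemma simplicial_sequence_exact:
  fixes G :: "'g monoid"
  assumes G: "comm_group G" and A: "A \<subseteq> points X"
  shows "cohomology_sequence_exact (simplicial_chains J (cl_subspace X A)) simplicial_inclusion
    (simplicial_chains J X) G"
proof -
  have sub: "singular_simplices J (cl_subspace X A) n \<subseteq> singular_simplices J X n" for n
    using cl_continuous_from_subspace[OF _ A] by (auto simp: singular_simplices_def)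
  interpret A: algebraic_complex "simplicial_chains J (cl_subspace X A)"
    by (rule algebraic_complex_simplicial)
  interpret X: algebraic_complex "simplicial_chains J X"
    by (rule algebraic_complex_simplicial)
  interpret chain_morphism "simplicial_chains J (cl_subspace X A)" "simplicial_chains J X" simplicial_inclusion
  proof
    fix n
    show "simplicial_inclusion n \<in> hom (grp (simplicial_chains J (cl_subspace X A)) n) (grp (simplicial_chains J X) n)"
      using sub[of n] by (auto intro!: homI simp: simplicial_inclusion_def simplicial_chains_def)
  qed (simp add: simplicial_inclusion_def simplicial_chains_def)
  show ?thesis
  proof (rule cohomology_sequence_exact_if_split[OF G])
    fix n
    show "\<exists>r\<in>hom (grp (simplicial_chains J X) n) (grp (simplicial_chains J (cl_subspace X A)) n).
      \<forall>x\<in>carrier (grp (simplicial_chains J (cl_subspace X A)) n). r (simplicial_inclusion n x) = x"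
      by (rule bexI[of _ "frag_restrict (singular_simplices J (cl_subspace X A) n)"])
        (simp_all add: simplicial_inclusion_def simplicial_chains_def frag_restrict_hom frag_restrict_id)
  qed
qed

section \<open>Singular cubes\<close>

lemma closure_space_interval_space: "closure_space (interval_space J)"
  by (cases J) (simp_all add: closure_space_topological closure_space_indiscrete closure_space_upward)

lemma endpoints_in_interval_space: "0 \<in> points (interval_space J)" "1 \<in> points (interval_space J)"
  by (cases J; simp add: topological_clspace_def indiscrete_clspace_def upward_clspace_def)+

lemma closure_space_tensor_power: "closure_space Y \<Longrightarrow> closure_space (tensor_power T Y n)"
proof (induction n)
  case (Suc n)
  have "inj_on (\<lambda>(x, xs). x # xs) S" for S :: "('a \<times> 'a list) set" by (auto simp: inj_on_def)
  then show ?case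
    using Suc by (simp add: closure_space_relabel closure_space_tensor_space)
qed (simp add: closure_space_indiscrete)

lemmas closure_space_cube = closure_space_tensor_power[OF closure_space_interval_space]

lemma points_tensor_power_length: "x \<in> points (tensor_power T Y n) \<Longrightarrow> length x = n"
  by (induction n arbitrary: x) (auto simp: indiscrete_clspace_def relabel_def)

lemma insert_coordinate_simps [simp]:
  "insert_coordinate (Suc 0) e xs = e # xs"
  "insert_coordinate (Suc (Suc k)) e (x # xs) = x # insert_coordinate (Suc k) e xs"
  by (simp_all add: insert_coordinate_def)

lemma insert_coordinate_nth:
  assumes "i \<le> length xs" "k \<le> length xs"
  shows "insert_coordinate (Suc i) e xs ! k = (if k < i then xs ! k else if k = i then e else xs ! (k - 1))"
  using assms by (auto simp: insert_coordinate_def nth_append nth_Cons')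

text \<open>The cocubical identity. Inserting at the earlier position first moves the later one up
  by one, whence the extra \<open>Suc\<close>.\<close>

lemma insert_coordinate_insert_coordinate:
  "i \<le> j \<Longrightarrow> j \<le> length xs \<Longrightarrow>
    insert_coordinate (Suc (Suc j)) e' (insert_coordinate (Suc i) e xs) =
    insert_coordinate (Suc i) e (insert_coordinate (Suc j) e' xs)"
proof (induction xs arbitrary: i j)
  case Nil
  then show ?case by simp
next
  case (Cons x xs)
  show ?case
  proof (cases i)
    case (Suc i')
    then obtain j' where "j = Suc j'" using Cons.prems by (cases j) auto
    then show ?thesis using Suc Cons by simp
  qed simp
qed

text \<open>Insertion at the front is a slice inclusion into a product. Insertion further back is
  the identity on the first coordinate times an insertion in a smaller power, which gives the
  induction.\<close>

lemma cl_continuous_insert_coordinate: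
  assumes Y: "closure_space Y" and e: "e \<in> points Y"
  shows "k \<le> m \<Longrightarrow>
    cl_continuous (tensor_power T Y m) (tensor_power T Y (Suc m)) (insert_coordinate (Suc k) e)"
proof (induction m arbitrary: k)
  note cube = closure_space_tensor_power[OF Y, of T]
  have front: "cl_continuous (tensor_power T Y m) (tensor_power T Y (Suc m)) (insert_coordinate (Suc 0) e)" for m
  proof -
    have "cl_continuous (tensor_power T Y m) (tensor_power T Y (Suc m)) ((\<lambda>(x, xs). x # xs) \<circ> (\<lambda>x. (e, x)))"
      unfolding tensor_power.simps
      by (intro cl_continuous_into_relabel closure_space_tensor_space Y cube cl_continuous_tensor_const e)
    then show ?thesis by (rule cl_continuous_cong[OF cube]) simp
  qed
  {
    case 0
    then have "k = 0" by simp
    then show ?case using front[of 0] by (simp only:)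
  next
    case (Suc m)
    show ?case
    proof (cases k)
      case 0
      then show ?thesis using front by (simp only:)
    next
      case (Suc k')
      then have "cl_continuous (tensor_power T Y m) (tensor_power T Y (Suc m)) (insert_coordinate (Suc k') e)"
        using Suc.IH Suc.prems by simp
      then have "cl_continuous (tensor_space T Y (tensor_power T Y m)) (tensor_space T Y (tensor_power T Y (Suc m)))
          (\<lambda>(y, x). (y, insert_coordinate (Suc k') e x))"
        by (rule cl_continuous_tensor_right[OF cube cube])
      then have "cl_continuous (relabel (\<lambda>(x, xs). x # xs) (tensor_space T Y (tensor_power T Y m)))
          (relabel (\<lambda>(x, xs). x # xs) (tensor_space T Y (tensor_power T Y (Suc m)))) (insert_coordinate (Suc k) e)"
        by (rule cl_continuous_relabel[rotated])
          (auto simp: Suc intro!: closure_space_tensor_space Y cube simp del: tensor_power.simps)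
      then show ?thesis by simp
    qed
  }
qed

lemma insert_coordinate_in_cube:
  assumes "x \<in> points (cube J T m)" "k \<le> m" "e \<in> {0, 1}"
  shows "insert_coordinate (Suc k) e x \<in> points (cube J T (Suc m))"
proof -
  have "e \<in> points (interval_space J)" using assms(3) endpoints_in_interval_space by auto
  from cl_continuous_insert_coordinate[OF closure_space_interval_space this assms(2)] assms(1)
  show ?thesis unfolding cl_continuous_def by blast
qed

lemma singular_cubes_face:
  assumes s: "\<sigma> \<in> singular_cubes J T X (int (Suc m))" and i: "i \<le> m" and e: "e \<in> {0, 1}"
  shows "cl_cube_face J T (Suc m) (Suc i) e \<sigma> \<in> singular_cubes J T X (int m)"
proof -
  have "e \<in> points (interval_space J)" using e endpoints_in_interval_space by auto
  note ins = cl_continuous_insert_coordinate[OF closure_space_interval_space this i]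
  have "cl_continuous (cube J T (Suc m)) X \<sigma>"
    using s unfolding singular_cubes_def nat_int by (simp del: tensor_power.simps of_nat_Suc)
  then have "cl_continuous (cube J T m) X (\<sigma> \<circ> insert_coordinate (Suc i) e)"
    by (rule cl_continuous_compose[OF ins])
  then have "cl_continuous (cube J T m) X (restrict (\<sigma> \<circ> insert_coordinate (Suc i) e) (points (cube J T m)))"
    by (rule cl_continuous_cong[OF closure_space_cube]) simp
  then show ?thesis
    by (simp add: singular_cubes_def cl_cube_face_def)
qed

text \<open>The endpoints \<open>e\<close> and \<open>e'\<close> vary independently, since composing
  two face differences produces all four combinations.\<close>

lemma cl_cube_face_face:
  assumes "i \<le> j" "j \<le> m" "e \<in> {0, 1}" "e' \<in> {0, 1}"
  shows "cl_cube_face J T (Suc m) (Suc i) e (cl_cube_face J T (Suc (Suc m)) (Suc (Suc j)) e' \<sigma>) =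
    cl_cube_face J T (Suc m) (Suc j) e' (cl_cube_face J T (Suc (Suc m)) (Suc i) e \<sigma>)"
proof (rule ext)
  fix x
  show "cl_cube_face J T (Suc m) (Suc i) e (cl_cube_face J T (Suc (Suc m)) (Suc (Suc j)) e' \<sigma>) x =
    cl_cube_face J T (Suc m) (Suc j) e' (cl_cube_face J T (Suc (Suc m)) (Suc i) e \<sigma>) x"
  proof (cases "x \<in> points (cube J T m)")
    case True
    then show ?thesis
      using assms insert_coordinate_in_cube[OF True, of i e] insert_coordinate_in_cube[OF True, of j e']
        insert_coordinate_insert_coordinate[of i j x e' e] points_tensor_power_length[OF True]
      by (simp add: cl_cube_face_def del: tensor_power.simps)
  qed (simp add: cl_cube_face_def)
qed

section \<open>Degenerate cubes and the normalized boundary\<close>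

text \<open>Counts coordinates from 0, as list positions are; \<open>degenerate_cubes_iff\<close>
  translates from the count that starts at 1.\<close>

definition independent_of :: "interval \<Rightarrow> tensor \<Rightarrow> nat \<Rightarrow> nat \<Rightarrow> (real list \<Rightarrow> 'a) \<Rightarrow> bool" where
  "independent_of J T n p \<sigma> \<longleftrightarrow> (\<forall>x \<in> points (cube J T n). \<forall>y \<in> points (cube J T n).
     (\<forall>k<n. k \<noteq> p \<longrightarrow> x ! k = y ! k) \<longrightarrow> \<sigma> x = \<sigma> y)"

lemma independent_ofD:
  assumes "independent_of J T n p \<sigma>" "x \<in> points (cube J T n)" "y \<in> points (cube J T n)"
    and "\<And>k. k < n \<Longrightarrow> k \<noteq> p \<Longrightarrow> x ! k = y ! k"
  shows "\<sigma> x = \<sigma> y"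
  using assms unfolding independent_of_def by blast

lemma degenerate_cubes_iff:
  "\<sigma> \<in> degenerate_cubes J T X (int n) \<longleftrightarrow>
    \<sigma> \<in> singular_cubes J T X (int n) \<and> (\<exists>p<n. independent_of J T n p \<sigma>)"
proof -
  have ex: "(\<exists>i\<in>{1..n}. P i) \<longleftrightarrow> (\<exists>p<n. P (Suc p))" for P
    by (metis atLeastAtMost_iff Suc_le_eq Suc_pred le_simps(3) less_eq_Suc_le One_nat_def zero_less_Suc)
  have all: "(\<forall>i\<in>{1..n}. P i) \<longleftrightarrow> (\<forall>p<n. P (Suc p))" for P
    using ex[of "\<lambda>i. \<not> P i"] by blast
  show ?thesis
    unfolding degenerate_cubes_def independent_of_def mem_Collect_eq nat_int ex all by simp
qed

lemma degenerate_cubes_face: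
  assumes s: "\<sigma> \<in> singular_cubes J T X (int (Suc m))"
    and indep: "independent_of J T (Suc m) p \<sigma>"
    and p: "p \<le> m" and i: "i \<le> m" "i \<noteq> p" and e: "e \<in> {0, 1}"
  shows "cl_cube_face J T (Suc m) (Suc i) e \<sigma> \<in> degenerate_cubes J T X (int m)"
  unfolding degenerate_cubes_iff independent_of_def
proof (intro conjI exI ballI impI)
  \<comment> \<open>Fixing coordinate \<open>i\<close> removes it from the face, so the ignored
    coordinate \<open>p\<close> moves down by one exactly when it lies behind
    \<open>i\<close>.\<close>
  let ?p = "if p < i then p else p - 1"
  show "cl_cube_face J T (Suc m) (Suc i) e \<sigma> \<in> singular_cubes J T X (int m)"
    using s i(1) e by (rule singular_cubes_face)
  show "?p < m" using p i by auto
  fix x y assume x: "x \<in> points (cube J T m)" and y: "y \<in> points (cube J T m)"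
    and xy: "\<forall>k<m. k \<noteq> ?p \<longrightarrow> x ! k = y ! k"
  have len: "length x = m" "length y = m" using x y points_tensor_power_length by blast+
  have "\<sigma> (insert_coordinate (Suc i) e x) = \<sigma> (insert_coordinate (Suc i) e y)"
  proof (rule independent_ofD[OF indep])
    fix k assume "k < Suc m" "k \<noteq> p"
    then have k: "k \<le> m" "k \<noteq> p" by simp_all
    have "x ! k = y ! k" if "k < i"
    proof -
      have "k < m" "k \<noteq> ?p" using that k i by auto
      then show ?thesis using xy by blast
    qed
    moreover have "x ! (k - 1) = y ! (k - 1)" if "k > i"
    proof -
      have "k - 1 < m" "k - 1 \<noteq> ?p" using that k i by auto
      then show ?thesis using xy by blast
    qed
    ultimately show "insert_coordinate (Suc i) e x ! k = insert_coordinate (Suc i) e y ! k"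
      using k i len by (simp add: insert_coordinate_nth)
  qed (rule insert_coordinate_in_cube x y i e)+
  then show "cl_cube_face J T (Suc m) (Suc i) e \<sigma> x = cl_cube_face J T (Suc m) (Suc i) e \<sigma> y"
    using x y by (simp add: cl_cube_face_def)
qed

text \<open>The two inserted lists differ only in the ignored coordinate \<open>p\<close>. Hence
  direction \<open>p\<close> contributes nothing to the boundary of a degenerate cube.\<close>

lemma independent_opposite_faces_eq:
  assumes indep: "independent_of J T (Suc m) p \<sigma>" and p: "p \<le> m"
  shows "cl_cube_face J T (Suc m) (Suc p) 0 \<sigma> = cl_cube_face J T (Suc m) (Suc p) 1 \<sigma>"
proof -
  have "\<sigma> (insert_coordinate (Suc p) 0 x) = \<sigma> (insert_coordinate (Suc p) 1 x)"
    if x: "x \<in> points (cube J T m)" for x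
  proof (rule independent_ofD[OF indep])
    have "length x = m" using x by (rule points_tensor_power_length)
    then show "insert_coordinate (Suc p) 0 x ! k = insert_coordinate (Suc p) 1 x ! k"
      if "k < Suc m" "k \<noteq> p" for k
      using that p by (simp add: insert_coordinate_nth)
  qed (rule insert_coordinate_in_cube[OF x p], simp)+
  then show ?thesis by (auto simp: cl_cube_face_def intro!: restrict_ext)
qed

text \<open>The order is reversed against the definition of the boundary (endpoint 1 minus endpoint
  0). This absorbs the sign that arises when the directions are counted from 0 instead of 1.\<close>

definition face_difference :: "interval \<Rightarrow> tensor \<Rightarrow> nat \<Rightarrow> nat \<Rightarrow> (real list \<Rightarrow> 'a) \<Rightarrow> (real list \<Rightarrow> 'a) \<Rightarrow>\<^sub>0 int" where
  "face_difference J T n i \<sigma> =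
     frag_of (cl_cube_face J T n (Suc i) 1 \<sigma>) - frag_of (cl_cube_face J T n (Suc i) 0 \<sigma>)"

definition cube_bd_gen :: "interval \<Rightarrow> tensor \<Rightarrow> int \<Rightarrow> (real list \<Rightarrow> 'a) \<Rightarrow> (real list \<Rightarrow> 'a) \<Rightarrow>\<^sub>0 int" where
  "cube_bd_gen J T n \<sigma> = (\<Sum>i<nat n. frag_cmul ((-1) ^ i) (face_difference J T (nat n) i \<sigma>))"

lemma cube_boundary_eq:
  "cube_boundary J T (nat n) = (frag_extend (cube_bd_gen J T n) :: ((real list \<Rightarrow> 'a) \<Rightarrow>\<^sub>0 int) \<Rightarrow> _)"
proof -
  have swap: "frag_cmul (- 1 * k) (a - b) = frag_cmul k (b - a)" for k and a b :: "(real list \<Rightarrow> 'a) \<Rightarrow>\<^sub>0 int"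
    by (rule poly_mapping_eqI) (simp add: lookup_minus right_diff_distrib)
  show ?thesis
    unfolding cube_boundary_def cube_bd_gen_def[abs_def] face_difference_def One_nat_def
      sum.atLeast1_atMost_eq power_Suc swap ..
qed

text \<open>\<open>S\<close> is arbitrary so that the lemma applies to the singular cubes as well as
  to the degenerate ones.\<close>

lemma keys_cube_bd_gen:
  assumes n: "n = int (Suc m)"
    and faces: "\<And>i. i \<le> m \<Longrightarrow> Poly_Mapping.keys (face_difference J T (Suc m) i \<sigma>) \<subseteq> S"
  shows "Poly_Mapping.keys (cube_bd_gen J T n \<sigma>) \<subseteq> S"
proof -
  have "(\<Sum>i<Suc m. frag_cmul ((-1) ^ i) (face_difference J T (Suc m) i \<sigma>)) \<in> carrier (free_Abelian_group S)"
  proof (rule sum_closed_free_Abelian_group)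
    fix i assume "i \<in> {..<Suc m}"
    then have "Poly_Mapping.keys (face_difference J T (Suc m) i \<sigma>) \<subseteq> S" by (intro faces) simp
    then show "frag_cmul ((-1) ^ i) (face_difference J T (Suc m) i \<sigma>) \<in> carrier (free_Abelian_group S)"
      by auto
  qed
  then show ?thesis unfolding cube_bd_gen_def n nat_int by (simp only: carrier_free_Abelian_group_iff)
qed

lemma keys_face_difference:
  assumes "cl_cube_face J T n (Suc i) 0 \<sigma> \<in> S" "cl_cube_face J T n (Suc i) 1 \<sigma> \<in> S"
  shows "Poly_Mapping.keys (face_difference J T n i \<sigma>) \<subseteq> S"
  unfolding face_difference_def by (rule order_trans[OF keys_diff]) (use assms in simp)

lemma cube_bd_gen_nonpos: "n \<le> 0 \<Longrightarrow> cube_bd_gen J T n \<sigma> = 0"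
  by (simp add: cube_bd_gen_def)

lemma algebraic_complex_all_cubical: "algebraic_complex (all_cubical_chains J T X)"
proof (rule algebraic_complex_free)
  fix n
  show "grp (all_cubical_chains J T X) n = free_Abelian_group (singular_cubes J T X n)"
    by (simp add: all_cubical_chains_def)
  show "bd (all_cubical_chains J T X) n = frag_extend (cube_bd_gen J T n)"
    by (simp add: all_cubical_chains_def cube_boundary_eq)
  fix \<sigma> assume s: "\<sigma> \<in> singular_cubes J T X n"
  show "Poly_Mapping.keys (cube_bd_gen J T n \<sigma>) \<subseteq> singular_cubes J T X (n - 1)"
  proof (cases "n \<le> 0")
    case False
    then obtain m where n: "n = int (Suc m)" using that[of "nat (n - 1)"] by simp
    have n1: "n - 1 = int m" by (simp add: n)
    have "Poly_Mapping.keys (face_difference J T (Suc m) i \<sigma>) \<subseteq> singular_cubes J T X (int m)"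
      if "i \<le> m" for i
      by (intro keys_face_difference singular_cubes_face[OF s[unfolded n] that]) simp_all
    then show ?thesis unfolding n1 by (rule keys_cube_bd_gen[OF n])
  qed (simp add: cube_bd_gen_nonpos)
  show "frag_extend (cube_bd_gen J T (n - 1)) (cube_bd_gen J T n \<sigma>) = 0"
  proof (cases "n \<le> 1")
    case True
    then show ?thesis by (intro frag_extend_eq_0) (simp add: cube_bd_gen_nonpos)
  next
    case False
    then obtain m where n: "n = int (Suc (Suc m))"
      using that[of "nat (n - 2)"] by simp
    have n1: "n - 1 = int (Suc m)" by (simp add: n)
    \<comment> \<open>\<open>n - 1\<close> is rewritten before \<open>n\<close>; the other order
      would destroy the term that \<open>n1\<close> matches.\<close>
    show ?thesis
      unfolding n1 unfolding n unfolding cube_bd_gen_def[abs_def] nat_int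
    proof (rule alternating_boundary_square)
      fix i j assume "i \<le> j" "j < Suc m"
      then show "frag_extend (face_difference J T (Suc m) i) (face_difference J T (Suc (Suc m)) (Suc j) \<sigma>) =
          frag_extend (face_difference J T (Suc m) j) (face_difference J T (Suc (Suc m)) i \<sigma>)"
        by (simp add: face_difference_def frag_extend_diff cl_cube_face_face)
    qed
  qed
qed

lemma degenerate_chains_eq:
  "degenerate_chains J T X n = {c. Poly_Mapping.keys c \<subseteq> degenerate_cubes J T X n}"
  unfolding degenerate_chains_def
  by (rule generate_free_Abelian_group) (auto simp: degenerate_cubes_def)

text \<open>In the ignored direction the opposite faces cancel; in all other directions both faces
  are again degenerate.\<close>

lemma keys_cube_bd_gen_degenerate:
  assumes "\<sigma> \<in> degenerate_cubes J T X n"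
  shows "Poly_Mapping.keys (cube_bd_gen J T n \<sigma>) \<subseteq> degenerate_cubes J T X (n - 1)"
proof (cases "n \<le> 0")
  case False
  then obtain m where n: "n = int (Suc m)" using that[of "nat (n - 1)"] by simp
  have n1: "n - 1 = int m" by (simp add: n)
  obtain p where s: "\<sigma> \<in> singular_cubes J T X (int (Suc m))" and "p < Suc m"
    and indep: "independent_of J T (Suc m) p \<sigma>"
    using assms unfolding n degenerate_cubes_iff by blast
  then have p: "p \<le> m" by simp
  have "Poly_Mapping.keys (face_difference J T (Suc m) i \<sigma>) \<subseteq> degenerate_cubes J T X (int m)"
    if i: "i \<le> m" for i
  proof (cases "i = p")
    case True
    have "cl_cube_face J T (Suc m) (Suc p) 0 \<sigma> = cl_cube_face J T (Suc m) (Suc p) 1 \<sigma>"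
      using indep p by (rule independent_opposite_faces_eq)
    then show ?thesis by (simp add: face_difference_def True)
  next
    case False
    have "cl_cube_face J T (Suc m) (Suc i) e \<sigma> \<in> degenerate_cubes J T X (int m)" if "e \<in> {0, 1}" for e
      by (rule degenerate_cubes_face[OF s indep p i False that])
    then show ?thesis by (intro keys_face_difference) auto
  qed
  then show ?thesis unfolding n1 by (rule keys_cube_bd_gen[OF n])
qed (simp add: cube_bd_gen_nonpos)

lemma subcomplex_degenerate: "subcomplex (all_cubical_chains J T X) (degenerate_chains J T X)"
proof (rule subcomplex.intro, rule algebraic_complex_all_cubical, rule subcomplex_axioms.intro)
  fix n
  have "frag_of ` degenerate_cubes J T X n \<subseteq> carrier (free_Abelian_group (singular_cubes J T X n))"
    by (auto simp: degenerate_cubes_def)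
  then show "subgroup (degenerate_chains J T X n) (grp (all_cubical_chains J T X) n)"
    unfolding degenerate_chains_def all_cubical_chains_def chain_complex.select_convs
    by (rule group.generate_is_subgroup[OF group_free_Abelian_group])
  have "Poly_Mapping.keys (frag_extend (cube_bd_gen J T n) c) \<subseteq> degenerate_cubes J T X (n - 1)"
    if "Poly_Mapping.keys c \<subseteq> degenerate_cubes J T X n" for c
    using keys_frag_extend[of "cube_bd_gen J T n" c] keys_cube_bd_gen_degenerate that by blast
  then show "bd (all_cubical_chains J T X) n ` degenerate_chains J T X n \<subseteq> degenerate_chains J T X (n - 1)"
    by (auto simp: degenerate_chains_eq all_cubical_chains_def cube_boundary_eq)
qed

lemma singular_cubes_subspace:
  "A \<subseteq> points X \<Longrightarrow> singular_cubes J T (cl_subspace X A) n \<subseteq> singular_cubes J T X n"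
  using cl_continuous_from_subspace[of _ X A] by (auto simp: singular_cubes_def)

text \<open>Degeneracy speaks only of the values of a cube as a function, not of the closure on its
  target.\<close>

lemma degenerate_cubes_subspace:
  "A \<subseteq> points X \<Longrightarrow> degenerate_cubes J T (cl_subspace X A) n =
    degenerate_cubes J T X n \<inter> singular_cubes J T (cl_subspace X A) n"
  using singular_cubes_subspace[of A X J T n] unfolding degenerate_cubes_def by blast

lemma cubical_sequence_exact:
  fixes G :: "'g monoid"
  assumes G: "comm_group G" and A: "A \<subseteq> points X"
  shows "cohomology_sequence_exact (cubical_chains J T (cl_subspace X A)) (cubical_inclusion J T X)
    (cubical_chains J T X) G"
proof -
  let ?A = "all_cubical_chains J T (cl_subspace X A)" and ?X = "all_cubical_chains J T X"
  let ?DA = "degenerate_chains J T (cl_subspace X A)" and ?DX = "degenerate_chains J T X"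
  note sub = singular_cubes_subspace[OF A] and deg = degenerate_cubes_subspace[OF A]
  interpret A: algebraic_complex ?A by (rule algebraic_complex_all_cubical)
  interpret X: algebraic_complex ?X by (rule algebraic_complex_all_cubical)
  interpret id: chain_morphism ?A ?X "\<lambda>n c. c"
  proof
    fix n
    show "(\<lambda>c. c) \<in> hom (grp ?A n) (grp ?X n)"
      using sub[of J T n] by (auto intro!: homI simp: all_cubical_chains_def)
  qed (simp add: all_cubical_chains_def)
  have DA: "?DA n = {c. Poly_Mapping.keys c \<subseteq> degenerate_cubes J T X n \<inter> singular_cubes J T (cl_subspace X A) n}" for n
    by (simp add: degenerate_chains_eq deg)
  have DAX: "(\<lambda>c. c) ` ?DA n \<subseteq> ?DX n" for n
    unfolding DA unfolding degenerate_chains_eq by auto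
  \<comment> \<open>Inserting the identity image exhibits \<open>cubical_inclusion\<close> as the
    map that \<open>id.quotient_morphism\<close> induces on normalized chains.\<close>
  have incl: "cubical_inclusion J T X = (\<lambda>n S. ?DX n <#>\<^bsub>grp ?X n\<^esub> ((\<lambda>c. c) ` S))"
    by (simp add: cubical_inclusion_def fun_eq_iff)
  interpret chain_morphism "cubical_chains J T (cl_subspace X A)" "cubical_chains J T X" "cubical_inclusion J T X"
    unfolding cubical_chains_def incl
    by (rule id.quotient_morphism[OF subcomplex_degenerate subcomplex_degenerate DAX])
  show ?thesis
  proof (rule cohomology_sequence_exact_if_split[OF G])
    fix n
    let ?r = "frag_restrict (singular_cubes J T (cl_subspace X A) n)"
    have "?r \<in> hom (grp ?X n) (grp ?A n)"
      by (simp add: all_cubical_chains_def frag_restrict_hom)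
    moreover have "?r ` ?DX n \<subseteq> ?DA n"
      \<comment> \<open>The retraction only shrinks supports. What remains of a degenerate chain of
        \<open>X\<close> is supported on degenerate cubes that lie in \<open>A\<close>, and by
        \<open>DA\<close> these are the degenerate cubes of \<open>A\<close>.\<close>
      unfolding DA unfolding degenerate_chains_eq using keys_frag_restrict by fastforce
    moreover have "?r c = c" if "c \<in> carrier (grp ?A n)" for c
      using that by (simp add: all_cubical_chains_def frag_restrict_id)
    ultimately show "\<exists>r\<in>hom (grp (cubical_chains J T X) n) (grp (cubical_chains J T (cl_subspace X A)) n).
      \<forall>S\<in>carrier (grp (cubical_chains J T (cl_subspace X A)) n). r (cubical_inclusion J T X n S) = S"
      unfolding cubical_chains_def incl
      by (rule id.quotient_split[OF subcomplex_degenerate subcomplex_degenerate DAX])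
  qed
qed

theorem theorem6p8:
  fixes J :: interval and T :: tensor and G :: "'g monoid"
    and X :: "'a clspace" and A :: "'a set"
  assumes "comm_group G"
    and "closure_space X"
    and "A \<subseteq> points X"
  shows "cohomology_sequence_exact
           (simplicial_chains J (cl_subspace X A)) simplicial_inclusion
           (simplicial_chains J X) G
       \<and> cohomology_sequence_exact
           (cubical_chains J T (cl_subspace X A)) (cubical_inclusion J T X)
           (cubical_chains J T X) G"
  using simplicial_sequence_exact[OF assms(1,3)] cubical_sequence_exact[OF assms(1,3)] ..

end
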